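(* Let $\mathbb{K}$ be a field of characteristic $0$. Let $p\in\mathbb{K}[x][y^{(\infty)}]$ be a differential polynomial of order $m$ and $q\in\mathbb{K}[x][z^{(\infty)}]$ a differential polynomial of order $n$. For $j\in\mathbb{N}$, let $\tilde p_j\in\mathbb{K}[y^{(\infty)},z]$ be obtained from the $j$-th derivative $p^{(j)}\in\mathbb{K}[x][y^{(\infty)}]$ by substituting $z$ for $x$, and let $$I^{(\le j)}=\langle \tilde p_0,\ldots,\tilde p_j,\;q,q',\ldots,q^{(j)}\rangle\subset\mathbb{K}[x][y^{(\infty)},z^{(\infty)}].$$ Define $S_j\in\mathbb{K}[x][y^{(\infty)},z^{(\infty)}]$ recursively by $S_0=y$ and, if $S_j=\sum_{i=0}^j c_i\,y^{(i)}$ with $c_i\in\mathbb{K}[z^{(\infty)}]$, then $$S_{j+1}=\sum_{i=0}^j\bigl(c_i'\,y^{(i)}+c_i\,z'\,y^{(i+1)}\bigr).$$ For $j\in\mathbb{N}$ let $$H_j=I^{(\le j)}+\bigl\langle\, w^{(i)}-S_i \;\big|\; 0\le i\le j+\min(m,n)\,\bigr\rangle\subset\mathbb{K}[x][y^{(\infty)},z^{(\infty)},w^{(\infty)}].$$ Then there exists $N\in\mathbb{N}$ such that $$H_N\cap\mathbb{K}[x][w^{(\infty)}]\;\neq\;\langle 0\rangle .$$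
   Context: $\mathbb{K}[x]$ is a differential ring with derivation $\partial/\partial x$. $\mathbb{K}[x][y^{(\infty)}]=\mathbb{K}[x][y,y',y'',\ldots]$ is the polynomial ring in infinitely many variables $y^{(j)}$ ($j\in\mathbb{N}$, $y^{(0)}=y$) with the derivation extending that of $\mathbb{K}[x]$ and satisfying $(y^{(j)})'=y^{(j+1)}$; rings in several differential indeterminates $y,z,w$ are defined analogously. The order of a non-zero differential polynomial in $y$ is the largest $m$ such that $y^{(m)}$ occurs in it. The derivatives $p^{(j)}$ are taken in $\mathbb{K}[x][y^{(\infty)}]$ (with $x'=1$) before the substitution of $z$ for $x$; the derivatives $q^{(j)}$ are taken in $\mathbb{K}[x][z^{(\infty)}]$; $c_i'$ is the derivative of $c_i$ in $\mathbb{K}[z^{(\infty)}]$. In the intended interpretation, $p$ vanishes at a function $f$, $q$ vanishes at a function $g$, the symbol $z^{(i)}$ stands for $g^{(i)}$, the symbol $y^{(i)}$ stands for $f^{(i)}\circ g$, and $w$ stands for $f\circ g$, so $S_j$ stands for $(f\circ g)^{(j)}$. The ideals $I^{(\le j)}$ and $H_j$ are ordinary (not differential) ideals; in the formula for $H_j$, $I^{(\le j)}$ means the ideal generated by it in the larger ring. *)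

theory Defs
  imports Complex_Main "HOL-Library.Poly_Mapping"
begin

section \<open>Polynomials in the indeterminates $x$, $y^{(j)}$, $z^{(j)}$, $w^{(j)}$\<close>

text \<open>
  All rings in question are subrings of the single ring $K[x][y^{(\infty)}, z^{(\infty)},
  w^{(\infty)}]$, the polynomials over $K$ in the indeterminates of type \<open>indet\<close>.
  A polynomial is a finitely supported map from monomials to coefficients, a monomial being a
  finitely supported exponent function.  The subring of polynomials in the indeterminates from
  \<open>V\<close> is \<open>polys_in V\<close>; for example $K[x][w^{(\infty)}]$ is
  \<open>polys_in ({Ix} \<union> range Iw)\<close>.
\<close>

datatype indet = Ix | Iy nat | Iz nat | Iw nat

type_synonym 'k dpoly = "(indet \<Rightarrow>\<^sub>0 nat) \<Rightarrow>\<^sub>0 'k"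

abbreviation coef :: "'k dpoly \<Rightarrow> (indet \<Rightarrow>\<^sub>0 nat) \<Rightarrow> 'k::zero"
  where "coef \<equiv> Poly_Mapping.lookup"

abbreviation expo :: "(indet \<Rightarrow>\<^sub>0 nat) \<Rightarrow> indet \<Rightarrow> nat"
  where "expo \<equiv> Poly_Mapping.lookup"

definition Const :: "'k::zero \<Rightarrow> 'k dpoly"
  where "Const a = Poly_Mapping.single 0 a"

definition Var :: "indet \<Rightarrow> 'k::zero_neq_one dpoly"
  where "Var v = Poly_Mapping.single (Poly_Mapping.single v 1) 1"

definition vars :: "'k::zero dpoly \<Rightarrow> indet set"
  where "vars f = (\<Union>t\<in>Poly_Mapping.keys f. Poly_Mapping.keys t)"

definition polys_in :: "indet set \<Rightarrow> 'k::zero dpoly set"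
  where "polys_in V = {f. vars f \<subseteq> V}"

text \<open>
  \<open>has_order u f k\<close>: the largest \<open>j\<close> such that \<open>u j\<close> occurs in \<open>f\<close> is \<open>k\<close>; in particular some
  \<open>u j\<close> occurs, so \<open>f\<close> is non-zero.  It is used with \<open>u = Iy\<close> and \<open>u = Iz\<close>.
\<close>

definition has_order :: "(nat \<Rightarrow> indet) \<Rightarrow> 'k::zero dpoly \<Rightarrow> nat \<Rightarrow> bool"
  where "has_order u f k \<longleftrightarrow> u k \<in> vars f \<and> (\<forall>j>k. u j \<notin> vars f)"


section \<open>Substitutions and derivations\<close>

text \<open>The $K$-linear map with prescribed values on the monomials.\<close>

definition lin_ext :: "((indet \<Rightarrow>\<^sub>0 nat) \<Rightarrow> 'k dpoly) \<Rightarrow> 'k::comm_ring_1 dpoly \<Rightarrow> 'k dpoly"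
  where "lin_ext g f = (\<Sum>t\<in>Poly_Mapping.keys f. Const (coef f t) * g t)"

definition subst :: "(indet \<Rightarrow> 'k dpoly) \<Rightarrow> 'k::comm_ring_1 dpoly \<Rightarrow> 'k dpoly"
  where "subst \<sigma> = lin_ext (\<lambda>t. \<Prod>v\<in>Poly_Mapping.keys t. \<sigma> v ^ expo t v)"

text \<open>
  The $K$-linear derivation with prescribed values \<open>\<delta> v\<close> on the indeterminates: a monomial
  \<open>t\<close> is sent to \<open>\<Sum>v. (\<partial>t/\<partial>v) * \<delta> v\<close>.
\<close>

definition deriv_ext :: "(indet \<Rightarrow> 'k dpoly) \<Rightarrow> 'k::comm_ring_1 dpoly \<Rightarrow> 'k dpoly"
  where "deriv_ext \<delta> = lin_ext (\<lambda>t. \<Sum>v\<in>Poly_Mapping.keys t.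
           of_nat (expo t v) * Poly_Mapping.single (t - Poly_Mapping.single v 1) 1 * \<delta> v)"

fun indet_deriv :: "indet \<Rightarrow> 'k::comm_ring_1 dpoly" where
  "indet_deriv Ix = 1"
| "indet_deriv (Iy j) = Var (Iy (Suc j))"
| "indet_deriv (Iz j) = Var (Iz (Suc j))"
| "indet_deriv (Iw j) = Var (Iw (Suc j))"

text \<open>
  The derivation of $K[x][y^{(\infty)}, z^{(\infty)}, w^{(\infty)}]$.  It restricts to the
  derivations of $K[x][y^{(\infty)}]$, $K[x][z^{(\infty)}]$ and $K[z^{(\infty)}]$.
\<close>

definition D :: "'k::comm_ring_1 dpoly \<Rightarrow> 'k dpoly"
  where "D = deriv_ext indet_deriv"


section \<open>The ideals\<close>

definition ideal_gen :: "'a::comm_ring_1 set \<Rightarrow> 'a set"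
  where "ideal_gen = module.span (*)"

lemma ideal_gen_explicit:
  "ideal_gen B = {(\<Sum>a\<in>t. r a * a) | t r. finite t \<and> t \<subseteq> (B :: 'a::comm_ring_1 set)}"
proof -
  interpret module "(*) :: 'a \<Rightarrow> 'a \<Rightarrow> 'a"
    by unfold_locales (auto simp: algebra_simps)
  show ?thesis by (simp add: ideal_gen_def span_explicit)
qed

definition p_tilde :: "'k::comm_ring_1 dpoly \<Rightarrow> nat \<Rightarrow> 'k dpoly"
  where "p_tilde p j = subst (Var(Ix := Var (Iz 0))) ((D ^^ j) p)"

text \<open>
  \<open>I_le p q j\<close> is $I^{(\leq j)}$, already extended to the ring
  $K[x][y^{(\infty)}, z^{(\infty)}, w^{(\infty)}]$.
\<close>

definition I_le :: "'k::comm_ring_1 dpoly \<Rightarrow> 'k dpoly \<Rightarrow> nat \<Rightarrow> 'k dpoly set"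
  where "I_le p q j = ideal_gen (p_tilde p ` {..j} \<union> (\<lambda>i. (D ^^ i) q) ` {..j})"

text \<open>
  \<open>S_coeff j i\<close> is the coefficient $c_i$ of $y^{(i)}$ in $S_j$.  The stated recursion for $S_j$ in
  terms of the (uniquely determined) $c_i$ is lemma \<open>S_Suc\<close> below.
\<close>

fun S_coeff :: "nat \<Rightarrow> nat \<Rightarrow> 'k::comm_ring_1 dpoly" where
  "S_coeff 0 i = (if i = 0 then 1 else 0)"
| "S_coeff (Suc j) i = D (S_coeff j i) + (if i = 0 then 0 else S_coeff j (i - 1) * Var (Iz 1))"

definition S :: "nat \<Rightarrow> 'k::comm_ring_1 dpoly"
  where "S j = (\<Sum>i\<le>j. S_coeff j i * Var (Iy i))"

definition H :: "'k::comm_ring_1 dpoly \<Rightarrow> 'k dpoly \<Rightarrow> nat \<Rightarrow> nat \<Rightarrow> nat \<Rightarrow> 'k dpoly set"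
  where "H p q m n j =
    {a + b | a b. a \<in> I_le p q j \<and>
                  b \<in> ideal_gen ((\<lambda>i. Var (Iw i) - S i) ` {..j + min m n})}"


section \<open>Substitutions are homomorphisms, and \<open>D\<close> is a derivation\<close>

lemma Const_0 [simp]: "Const 0 = 0"
  by (simp add: Const_def)

lemma Const_1 [simp]: "Const 1 = 1"
  by (simp add: Const_def)

lemma Const_add: "Const (a + b) = Const a + Const b"
  by (simp add: Const_def single_add)

lemma Const_mult: "Const (a * b) = Const a * (Const b :: 'k::comm_ring_1 dpoly)"
  by (simp add: Const_def mult_single)

lemma lin_ext_superset:
  assumes "finite A" "Poly_Mapping.keys f \<subseteq> A"
  shows "lin_ext g f = (\<Sum>t\<in>A. Const (coef f t) * g t)"
  unfolding lin_ext_def using assms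
  by (intro sum.mono_neutral_left) (auto simp: in_keys_iff)

lemma lin_ext_add: "lin_ext g (f1 + f2) = lin_ext g f1 + lin_ext g f2"
proof -
  let ?A = "Poly_Mapping.keys f1 \<union> Poly_Mapping.keys f2"
  have "Poly_Mapping.keys (f1 + f2) \<subseteq> ?A"
    by (rule Poly_Mapping.keys_add)
  then show ?thesis
    by (simp add: lin_ext_superset[of ?A] lookup_add Const_add algebra_simps sum.distrib)
qed

lemma lin_ext_0 [simp]: "lin_ext g 0 = 0"
  by (simp add: lin_ext_def)

lemma lin_ext_sum: "lin_ext g (sum f A) = (\<Sum>a\<in>A. lin_ext g (f a))"
  by (induction A rule: infinite_finite_induct) (auto simp: lin_ext_add)

lemma lin_ext_single: "lin_ext g (Poly_Mapping.single t a) = Const a * g t"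
  by (subst lin_ext_superset[of "{t}"]) (auto split: if_splits)

lemma dpoly_expand:
  fixes f :: "'k::comm_ring_1 dpoly"
  shows "f = (\<Sum>t\<in>Poly_Mapping.keys f. Poly_Mapping.single t (coef f t))"
  by (rule poly_mapping_eqI)
     (auto simp: lookup_sum lookup_single when_def in_keys_iff)

lemma dpoly_induct [case_names single add]:
  fixes f :: "'k::comm_ring_1 dpoly"
  assumes single: "\<And>t a. P (Poly_Mapping.single t a)"
    and add: "\<And>f g. P f \<Longrightarrow> P g \<Longrightarrow> P (f + g)"
  shows "P f"
proof -
  have 0: "P 0" using single[of 0 0] by simp
  have "P (\<Sum>t\<in>A. Poly_Mapping.single t (coef f t))" for A
    by (induction A rule: infinite_finite_induct) (auto intro: single add 0)
  then show ?thesis by (subst dpoly_expand)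
qed

lemma subst_add: "subst \<sigma> (f + g) = subst \<sigma> f + subst \<sigma> g"
  by (simp add: subst_def lin_ext_add)

lemma subst_Const: "subst \<sigma> (Const a) = Const a"
  by (simp add: subst_def lin_ext_def Const_def)

lemma subst_Var: "subst \<sigma> (Var v) = \<sigma> v"
  by (simp add: subst_def Var_def lin_ext_single)

lemma subst_mult: "subst \<sigma> (f * g) = subst \<sigma> f * subst \<sigma> g"
proof -
  define M where "M t = (\<Prod>v\<in>Poly_Mapping.keys t. \<sigma> v ^ expo t v)" for t
  have M: "M t = (\<Prod>v\<in>A. \<sigma> v ^ expo t v)" if "finite A" "Poly_Mapping.keys t \<subseteq> A" for A t
    unfolding M_def using that by (intro prod.mono_neutral_left) (auto simp: in_keys_iff)
  have Madd: "M (s + t) = M s * M t" for s t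
  proof -
    let ?A = "Poly_Mapping.keys s \<union> Poly_Mapping.keys t"
    have "Poly_Mapping.keys (s + t) \<subseteq> ?A" by (rule Poly_Mapping.keys_add)
    then show ?thesis
      by (simp add: M[of ?A] lookup_add power_add prod.distrib)
  qed
  have subst: "subst \<sigma> = lin_ext M" by (simp add: subst_def M_def[abs_def])
  show ?thesis unfolding subst
  proof (induction f rule: dpoly_induct)
    case (single s a)
    show ?case
    proof (induction g rule: dpoly_induct)
      case (single t b)
      show ?case by (simp add: mult_single lin_ext_single Madd Const_mult algebra_simps)
    qed (simp add: distrib_left lin_ext_add)
  qed (simp add: distrib_right lin_ext_add)
qed

lemma deriv_ext_add: "deriv_ext \<delta> (f + g) = deriv_ext \<delta> f + deriv_ext \<delta> g"
  by (simp add: deriv_ext_def lin_ext_add)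

lemma deriv_ext_0 [simp]: "deriv_ext \<delta> 0 = 0"
  by (simp add: deriv_ext_def)

lemma deriv_ext_sum: "deriv_ext \<delta> (sum f A) = (\<Sum>a\<in>A. deriv_ext \<delta> (f a))"
  by (simp add: deriv_ext_def lin_ext_sum)

lemma deriv_ext_Const [simp]: "deriv_ext \<delta> (Const a) = 0"
  by (simp add: deriv_ext_def Const_def lin_ext_single)

lemma deriv_ext_Var [simp]: "deriv_ext \<delta> (Var v) = \<delta> v"
  by (simp add: deriv_ext_def Var_def lin_ext_single)

lemma deriv_ext_mult: "deriv_ext \<delta> (f * g) = deriv_ext \<delta> f * g + f * deriv_ext \<delta> g"
proof -
  define X where "X t = (Poly_Mapping.single t 1 :: 'a dpoly)" for t
  define e where "e v = (Poly_Mapping.single v 1 :: indet \<Rightarrow>\<^sub>0 nat)" for v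
  define M where "M t = (\<Sum>v\<in>Poly_Mapping.keys t. of_nat (expo t v) * X (t - e v) * \<delta> v)" for t
  have M: "M t = (\<Sum>v\<in>A. of_nat (expo t v) * X (t - e v) * \<delta> v)"
    if "finite A" "Poly_Mapping.keys t \<subseteq> A" for A t
    unfolding M_def using that by (intro sum.mono_neutral_left) (auto simp: in_keys_iff)
  have Xadd: "X (s + t) = X s * X t" for s t
    by (simp add: X_def mult_single)
  have shift: "of_nat (expo t v) * X (s + t - e v) = of_nat (expo t v) * X s * X (t - e v)" for s t v
  proof (cases "expo t v = 0")
    case False
    then have "s + t - e v = s + (t - e v)"
      by (intro poly_mapping_eqI) (auto simp: e_def lookup_add lookup_minus lookup_single when_def)
    then show ?thesis by (simp add: Xadd mult.assoc)
  qed simp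
  have Madd: "M (s + t) = M s * X t + X s * M t" for s t
  proof -
    let ?A = "Poly_Mapping.keys s \<union> Poly_Mapping.keys t"
    have "Poly_Mapping.keys (s + t) \<subseteq> ?A" by (rule Poly_Mapping.keys_add)
    then have "M (s + t) = (\<Sum>v\<in>?A. of_nat (expo (s + t) v) * X (s + t - e v) * \<delta> v)"
      by (intro M) auto
    also have "\<dots> = (\<Sum>v\<in>?A. of_nat (expo s v) * X (s - e v) * \<delta> v * X t
                        + X s * (of_nat (expo t v) * X (t - e v) * \<delta> v))"
    proof (rule sum.cong[OF refl])
      fix v
      have "of_nat (expo (s + t) v) * X (s + t - e v) * \<delta> v
            = (of_nat (expo s v) * X (t + s - e v) + of_nat (expo t v) * X (s + t - e v)) * \<delta> v"
        by (simp add: lookup_add algebra_simps)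
      also have "\<dots> = of_nat (expo s v) * X (s - e v) * \<delta> v * X t
                        + X s * (of_nat (expo t v) * X (t - e v) * \<delta> v)"
        unfolding shift by (simp add: algebra_simps)
      finally show "of_nat (expo (s + t) v) * X (s + t - e v) * \<delta> v = \<dots>" .
    qed
    also have "\<dots> = M s * X t + X s * M t"
      by (simp add: M[of ?A] sum.distrib sum_distrib_left sum_distrib_right)
    finally show ?thesis .
  qed
  have dv: "deriv_ext \<delta> = lin_ext M" by (simp add: deriv_ext_def M_def[abs_def] X_def e_def)
  have sX: "Poly_Mapping.single t a = Const a * X t" for t and a :: 'a
    by (simp add: Const_def X_def mult_single)
  show ?thesis unfolding dv
  proof (induction f rule: dpoly_induct)
    case (single s a)
    show ?case
    proof (induction g rule: dpoly_induct)
      case (single t b)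
      have "lin_ext M (Poly_Mapping.single s a * Poly_Mapping.single t b)
            = Const a * Const b * (M s * X t + X s * M t)"
        by (simp add: mult_single lin_ext_single Madd Const_mult)
      then show ?case
        unfolding lin_ext_single unfolding sX by (simp add: algebra_simps)
    qed (simp add: distrib_left lin_ext_add algebra_simps)
  qed (simp add: distrib_right lin_ext_add algebra_simps)
qed

lemma D_Const: "D (Const a) = 0" and D_Var: "D (Var v) = indet_deriv v"
  and D_add: "D (f + g) = D f + D g" and D_mult: "D (f * g) = D f * g + f * D g"
  by (simp_all add: D_def deriv_ext_add deriv_ext_mult)


section \<open>The recursion for \<open>S\<close>\<close>

lemma S_coeff_eq_0: "i > j \<Longrightarrow> S_coeff j i = 0"
  by (induction j arbitrary: i) (auto simp: D_def)

lemma vars_subsets: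
  fixes f g :: "'k::comm_ring_1 dpoly"
  shows vars_add: "vars (f + g) \<subseteq> vars f \<union> vars g"
    and vars_mult: "vars (f * g) \<subseteq> vars f \<union> vars g"
proof -
  show "vars (f + g) \<subseteq> vars f \<union> vars g"
    using Poly_Mapping.keys_add[of f g] by (auto simp: vars_def)
  show "vars (f * g) \<subseteq> vars f \<union> vars g"
  proof
    fix v assume "v \<in> vars (f * g)"
    then obtain t where t: "t \<in> Poly_Mapping.keys (f * g)" "v \<in> Poly_Mapping.keys t"
      by (auto simp: vars_def)
    from t(1) obtain a b where "t = a + b" "a \<in> Poly_Mapping.keys f" "b \<in> Poly_Mapping.keys g"
      using keys_mult[of f g] by blast
    then show "v \<in> vars f \<union> vars g"
      using t(2) Poly_Mapping.keys_add[of a b] by (auto simp: vars_def)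
  qed
qed

lemma polys_in_0 [simp]: "0 \<in> polys_in V"
  and polys_in_1 [simp]: "(1 :: 'k::comm_ring_1 dpoly) \<in> polys_in V"
  and polys_in_Var: "v \<in> V \<Longrightarrow> (Var v :: 'k::comm_ring_1 dpoly) \<in> polys_in V"
  by (auto simp: polys_in_def vars_def Var_def)

lemma polys_in_add: "f \<in> polys_in V \<Longrightarrow> g \<in> polys_in V \<Longrightarrow> f + g \<in> polys_in V"
  and polys_in_mult: "f \<in> polys_in V \<Longrightarrow> g \<in> polys_in V \<Longrightarrow> f * g \<in> polys_in V"
  for f g :: "'k::comm_ring_1 dpoly"
  using vars_add[of f g] vars_mult[of f g] by (auto simp: polys_in_def)

lemma polys_in_sum: "(\<And>a. a \<in> A \<Longrightarrow> h a \<in> polys_in V) \<Longrightarrow> sum h A \<in> polys_in V"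
  for h :: "_ \<Rightarrow> 'k::comm_ring_1 dpoly"
  by (induction A rule: infinite_finite_induct) (auto intro: polys_in_add)

lemma polys_in_deriv_ext:
  fixes f :: "'k::comm_ring_1 dpoly"
  assumes f: "f \<in> polys_in V" and \<delta>: "\<And>v. v \<in> V \<Longrightarrow> \<delta> v \<in> polys_in V"
  shows "deriv_ext \<delta> f \<in> polys_in V"
  unfolding deriv_ext_def lin_ext_def
proof (intro polys_in_sum polys_in_mult)
  fix t v assume t: "t \<in> Poly_Mapping.keys f" and v: "v \<in> Poly_Mapping.keys t"
  have tV: "Poly_Mapping.keys t \<subseteq> V" using f t by (auto simp: polys_in_def vars_def)
  show "\<delta> v \<in> polys_in V" using \<delta> tV v by auto
  have "Poly_Mapping.keys (t - Poly_Mapping.single v 1) \<subseteq> Poly_Mapping.keys t"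
    by (auto simp: in_keys_iff lookup_minus)
  then show "Poly_Mapping.single (t - Poly_Mapping.single v 1) 1 \<in> polys_in V"
    using tV by (auto simp: polys_in_def vars_def)
  show "of_nat (expo t v) \<in> polys_in V"
    by (induction "expo t v") (auto simp: polys_in_def vars_def simp flip: single_of_nat)
next
  fix t show "Const (coef f t) \<in> polys_in V" by (auto simp: polys_in_def vars_def Const_def)
qed

lemma S_coeff_in: "S_coeff j i \<in> polys_in (range Iz)"
  by (induction j arbitrary: i)
     (auto simp: D_def intro!: polys_in_add polys_in_mult polys_in_Var polys_in_deriv_ext)

lemma deriv_ext_eq_0:
  assumes "f \<in> polys_in V" and "\<And>v. v \<in> V \<Longrightarrow> \<delta> v = 0"
  shows "deriv_ext \<delta> f = 0"
proof -
  have "\<delta> v = 0" if "t \<in> Poly_Mapping.keys f" "v \<in> Poly_Mapping.keys t" for t v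
    using assms that by (auto simp: polys_in_def vars_def)
  then show ?thesis by (simp add: deriv_ext_def lin_ext_def)
qed

lemma y_coeffs_unique:
  assumes "\<And>i. i \<le> j \<Longrightarrow> c i \<in> polys_in (range Iz)" "i \<le> j"
    and eq: "f = (\<Sum>k\<le>j. c k * Var (Iy k))"
  shows "c i = deriv_ext (\<lambda>v. if v = Iy i then 1 else 0) f"
proof -
  have 0: "deriv_ext (\<lambda>v. if v = Iy i then 1 else 0) (c k) = 0" if "k \<le> j" for k
    using assms(1)[OF that] by (rule deriv_ext_eq_0) auto
  have "deriv_ext (\<lambda>v. if v = Iy i then 1 else 0) f = (\<Sum>k\<le>j. if k = i then c k else 0)"
    unfolding eq deriv_ext_sum by (intro sum.cong) (auto simp: deriv_ext_mult 0)
  then show ?thesis using assms(2) by simp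
qed

lemma S_0: "S 0 = Var (Iy 0)"
  by (simp add: S_def)

theorem S_Suc:
  assumes "\<And>i. i \<le> j \<Longrightarrow> c i \<in> polys_in (range Iz)"
    and "S j = (\<Sum>i\<le>j. c i * Var (Iy i))"
  shows "S (Suc j) = (\<Sum>i\<le>j. D (c i) * Var (Iy i) + c i * Var (Iz 1) * Var (Iy (Suc i)))"
proof -
  have c: "c i = S_coeff j i" if "i \<le> j" for i
    using y_coeffs_unique[OF assms(1) that assms(2)]
      y_coeffs_unique[OF S_coeff_in that S_def] by metis
  have "S (Suc j) = (\<Sum>i\<le>Suc j. D (S_coeff j i) * Var (Iy i))
      + (\<Sum>i\<le>Suc j. (if i = 0 then 0 else S_coeff j (i - 1) * Var (Iz 1)) * Var (Iy i))"
    by (simp add: S_def distrib_right sum.distrib del: sum.atMost_Suc)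
  also have "(\<Sum>i\<le>Suc j. D (S_coeff j i) * Var (Iy i)) = (\<Sum>i\<le>j. D (S_coeff j i) * Var (Iy i))"
    by (simp add: S_coeff_eq_0 D_def)
  also have "(\<Sum>i\<le>Suc j. (if i = 0 then 0 else S_coeff j (i - 1) * Var (Iz 1)) * Var (Iy i))
      = (\<Sum>i\<le>j. S_coeff j i * Var (Iz 1) * Var (Iy (Suc i)))"
    by (subst sum.atMost_Suc_shift) simp
  finally show ?thesis by (simp add: sum.distrib c)
qed

end

theory Submission
  imports Defs "HOL-Library.FuncSet"
begin

text \<open>
  Let $\Delta$ be the derivation with $\Delta x = 1$, $\Delta z^{(j)} = z^{(j+1)}$,
  $\Delta w^{(j)} = w^{(j+1)}$ and, by the chain rule, $\Delta y^{(j)} = z' y^{(j+1)}$.  Then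
  $\Delta \tilde p_j = z' \tilde p_{j+1}$ and $\Delta S_j = S_{j+1}$, so $\bigcup_N H_N$ is a
  $\Delta$-stable ideal.  If it met $K[x][w^{(\infty)}]$ only in $0$, it would be contained in a
  prime ideal with the same property, whose largest $\Delta$-stable subset $J$ is again a prime
  ideal, as the characteristic is $0$.  Modulo $J$, $z'$ is non-zero (otherwise $w' \in J$), hence
  $\Delta / z'$ acts as $y^{(j)} \mapsto y^{(j+1)}$, $z \mapsto 1$.  Differentiating a
  non-zero relation of least degree among $x$ and the $z^{(j)}$, and likewise among $z$ and the
  $y^{(j)}$, shows that all $y^{(j)}$ and $z^{(j)}$, and with them all $w^{(j)}$, are
  modulo $J$ in a finitely generated ring $K[W]_s$.  More than $|W|$ of the elements
  $x, w, w', \ldots$ are then algebraically dependent over $K$, a contradiction.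
\<close>

section \<open>Prime ideals\<close>

lemma module_mult: "module ((*) :: 'a::comm_ring_1 \<Rightarrow> 'a \<Rightarrow> 'a)"
  by unfold_locales (auto simp: algebra_simps)

locale ring_ideal =
  fixes J :: "'a::comm_ring_1 set"
  assumes zero_mem: "0 \<in> J"
    and add_mem: "a \<in> J \<Longrightarrow> b \<in> J \<Longrightarrow> a + b \<in> J"
    and mult_mem: "a \<in> J \<Longrightarrow> r * a \<in> J"
begin

lemma mult_mem2: "a \<in> J \<Longrightarrow> a * r \<in> J"
  using mult_mem[of a r] by (simp add: mult.commute)

lemma minus_mem: "a \<in> J \<Longrightarrow> - a \<in> J"
  using mult_mem[of a "-1"] by simp

lemma diff_mem: "a \<in> J \<Longrightarrow> b \<in> J \<Longrightarrow> a - b \<in> J"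
  using add_mem[of a "- b"] minus_mem[of b] by simp

lemma sum_mem: "(\<And>i. i \<in> A \<Longrightarrow> f i \<in> J) \<Longrightarrow> sum f A \<in> J"
  by (induction A rule: infinite_finite_induct) (auto intro: zero_mem add_mem)

lemma cong_mult:
  assumes "a - b \<in> J" "c - d \<in> J"
  shows "a * c - b * d \<in> J"
proof -
  have "a * c - b * d = (a - b) * c + b * (c - d)" by (simp add: algebra_simps)
  then show ?thesis using assms by (auto intro: add_mem mult_mem mult_mem2)
qed

lemma cong_power: "a - b \<in> J \<Longrightarrow> a ^ k - b ^ k \<in> J"
  by (induction k) (auto intro: cong_mult zero_mem)

lemma cong_prod: "(\<And>i. i \<in> A \<Longrightarrow> f i - g i \<in> J) \<Longrightarrow> prod f A - prod g A \<in> J"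
  by (induction A rule: infinite_finite_induct) (auto intro: cong_mult zero_mem)

end

locale prime_ideal = ring_ideal +
  assumes one_notin: "1 \<notin> J"
    and prime: "a * b \<in> J \<Longrightarrow> a \<in> J \<or> b \<in> J"
begin

lemma power_notin: "a \<notin> J \<Longrightarrow> a ^ k \<notin> J"
  by (induction k) (auto simp: one_notin dest: prime)

end

lemma ring_ideal_ideal_gen: "ring_ideal (ideal_gen B)"
  unfolding ideal_gen_def
  by unfold_locales
     (auto intro: module.span_zero module.span_add module.span_scale module_mult)

lemma ideal_gen_induct [consumes 1, case_names base zero add mult]:
  assumes "a \<in> ideal_gen B" "\<And>a. a \<in> B \<Longrightarrow> P a" "P 0"
    "\<And>a b. P a \<Longrightarrow> P b \<Longrightarrow> P (a + b)" "\<And>r a. P a \<Longrightarrow> P (r * a)"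
  shows "P a"
proof -
  have "module.subspace (*) {a. P a}"
    using assms(3-5) by (auto simp: module.subspace_def[OF module_mult])
  then show ?thesis
    using module.span_minimal[OF module_mult, of B "{a. P a}"] assms(1,2)
    unfolding ideal_gen_def by auto
qed

text \<open>By Zorn's lemma there is an ideal \<open>J\<close> maximal among those containing
  \<open>I\<close> and disjoint from \<open>M\<close>. If \<open>a\<close> and \<open>b\<close> lie
  outside \<open>J\<close>, the larger ideals \<open>J + (a)\<close> and \<open>J + (b)\<close> meet
  \<open>M\<close>; the product of the two elements found there lies in \<open>M\<close>, and it
  would lie in \<open>J\<close> if \<open>a * b\<close> did.\<close>

theorem ex_prime_ideal_disjoint:
  fixes I M :: "'a::comm_ring_1 set"
  assumes I: "ring_ideal I" and one: "1 \<in> M"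
    and mult: "\<And>a b. a \<in> M \<Longrightarrow> b \<in> M \<Longrightarrow> a * b \<in> M" and disj: "I \<inter> M = {}"
  shows "\<exists>J. I \<subseteq> J \<and> prime_ideal J \<and> J \<inter> M = {}"
proof -
  define \<A> where "\<A> = {J. ring_ideal J \<and> I \<subseteq> J \<and> J \<inter> M = {}}"
  have "\<exists>J\<in>\<A>. \<forall>X\<in>\<A>. J \<subseteq> X \<longrightarrow> X = J"
  proof (rule subset_Zorn_nonempty)
    show "\<A> \<noteq> {}" using I disj by (auto simp: \<A>_def)
  next
    fix C assume ne: "C \<noteq> {}" and chain: "subset.chain \<A> C"
    have C: "ring_ideal X" "I \<subseteq> X" "X \<inter> M = {}" if "X \<in> C" for X
      using chain that by (auto simp: subset.chain_def \<A>_def)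
    have "ring_ideal (\<Union>C)"
    proof
      obtain X where "X \<in> C" using ne by blast
      then show "0 \<in> \<Union>C" using C(1) ring_ideal.zero_mem by blast
    next
      fix a b assume "a \<in> \<Union>C" "b \<in> \<Union>C"
      then obtain X Y where XY: "X \<in> C" "a \<in> X" "Y \<in> C" "b \<in> Y" by auto
      then have "X \<subseteq> Y \<or> Y \<subseteq> X"
        using chain by (auto simp: subset_chain_def)
      then obtain Z where "Z \<in> C" "a \<in> Z" "b \<in> Z" using XY by blast
      then show "a + b \<in> \<Union>C" using C(1) ring_ideal.add_mem by blast
    next
      fix a r assume "a \<in> \<Union>C"
      then show "r * a \<in> \<Union>C" using C(1) ring_ideal.mult_mem by blast
    qed
    moreover have "I \<subseteq> \<Union>C" using ne C(2) by auto
    ultimately show "\<Union>C \<in> \<A>" using C(3) by (auto simp: \<A>_def)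
  qed
  then obtain J where J: "ring_ideal J" "I \<subseteq> J" "J \<inter> M = {}"
    and max: "\<And>X. ring_ideal X \<Longrightarrow> I \<subseteq> X \<Longrightarrow> X \<inter> M = {} \<Longrightarrow> J \<subseteq> X \<Longrightarrow> X = J"
    by (auto simp: \<A>_def)
  interpret J: ring_ideal J by fact
  have meet: "\<exists>j r. j \<in> J \<and> j + r * a \<in> M" if "a \<notin> J" for a
  proof (rule ccontr)
    assume no: "\<nexists>j r. j \<in> J \<and> j + r * a \<in> M"
    define X where "X = {j + r * a | j r. j \<in> J}"
    have X: "j + r * a \<in> X" if "j \<in> J" for j r
      using that unfolding X_def by blast
    have "J \<subseteq> X"
    proof
      fix j assume "j \<in> J"
      then show "j \<in> X" using X[of j 0] by simp
    qed
    have "a \<in> X" using X[of 0 1] J.zero_mem by simp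
    have "ring_ideal X"
    proof
      show "0 \<in> X" using \<open>J \<subseteq> X\<close> J.zero_mem by blast
    next
      fix b c assume "b \<in> X" "c \<in> X"
      then obtain j r j' r' where "b = j + r * a" "c = j' + r' * a" "j \<in> J" "j' \<in> J"
        unfolding X_def by blast
      then have "b + c = (j + j') + (r + r') * a" "j + j' \<in> J"
        by (simp_all add: distrib_right add_ac J.add_mem)
      then show "b + c \<in> X" using X by simp
    next
      fix b c assume "b \<in> X"
      then obtain j r where "b = j + r * a" and "j \<in> J"
        unfolding X_def mem_Collect_eq by metis
      have "c * (j + r * a) = c * j + (c * r) * a" by (simp add: algebra_simps)
      also have "\<dots> \<in> X" using \<open>j \<in> J\<close> by (intro X J.mult_mem)
      finally show "c * b \<in> X" by (simp only: \<open>b = j + r * a\<close>)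
    qed
    moreover have "X \<inter> M = {}" using no unfolding X_def by blast
    ultimately have "X = J" using \<open>J \<subseteq> X\<close> \<open>I \<subseteq> J\<close> max by blast
    then show False using \<open>a \<in> X\<close> that by simp
  qed
  have "prime_ideal J"
  proof
    show "1 \<notin> J" using one J(3) by auto
  next
    fix a b assume ab: "a * b \<in> J"
    show "a \<in> J \<or> b \<in> J"
    proof (rule ccontr)
      assume "\<not> (a \<in> J \<or> b \<in> J)"
      then obtain j r j' r' where *: "j \<in> J" "j + r * a \<in> M" "j' \<in> J" "j' + r' * b \<in> M"
        using meet by metis
      have "(j + r * a) * (j' + r' * b) = j * (j' + r' * b) + ((r * a) * j' + (r * r') * (a * b))"
        by (simp add: algebra_simps)
      also have "\<dots> \<in> J"
        by (intro J.add_mem J.mult_mem2[OF *(1)] J.mult_mem[OF *(3)] J.mult_mem[OF ab])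
      finally show False using mult[OF *(2) *(4)] J(3) by blast
    qed
  qed
  then show ?thesis using J by auto
qed


section \<open>The differential core of a prime ideal\<close>

lemma Leibniz_rule:
  fixes d :: "'a::comm_ring_1 \<Rightarrow> 'a"
  assumes add: "\<And>a b. d (a + b) = d a + d b" and mult: "\<And>a b. d (a * b) = d a * b + a * d b"
  shows "(d ^^ k) (a * b) = (\<Sum>i\<le>k. of_nat (k choose i) * ((d ^^ i) a * (d ^^ (k - i)) b))"
proof (induction k)
  case (Suc k)
  let ?t = "\<lambda>i j. (d ^^ i) a * (d ^^ j) b"
  have d0: "d 0 = 0" using add[of 0 0] by simp
  have dsum: "d (sum f A) = (\<Sum>x\<in>A. d (f x))" for f and A :: "nat set"
    by (induction A rule: infinite_finite_induct) (auto simp: d0 add)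
  have d1: "d 1 = 0" using mult[of 1 1] by simp
  have dn: "d (of_nat n) = 0" for n
    by (induction n) (auto simp: d0 d1 add)
  have "(d ^^ Suc k) (a * b)
      = (\<Sum>i\<le>k. of_nat (k choose i) * ?t (Suc i) (k - i))
        + (\<Sum>i\<le>k. of_nat (k choose i) * ?t i (Suc k - i))"
    by (simp add: Suc.IH dsum dn mult Suc_diff_le algebra_simps sum.distrib)
  also have "(\<Sum>i\<le>k. of_nat (k choose i) * ?t i (Suc k - i))
      = (\<Sum>i\<le>Suc k. of_nat (k choose i) * ?t i (Suc k - i))"
    by (simp add: binomial_eq_0)
  also have "\<dots> = ?t 0 (Suc k) + (\<Sum>i\<le>k. of_nat (k choose Suc i) * ?t (Suc i) (k - i))"
    by (subst sum.atMost_Suc_shift) simp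
  also have "(\<Sum>i\<le>k. of_nat (k choose i) * ?t (Suc i) (k - i)) + \<dots>
      = (\<Sum>i\<le>Suc k. of_nat (Suc k choose i) * ?t i (Suc k - i))"
    by (subst sum.atMost_Suc_shift) (simp add: sum.distrib algebra_simps)
  finally show ?case .
qed simp

text \<open>For \<open>a\<close> and \<open>b\<close> outside the core, let \<open>k\<close> and
  \<open>l\<close> be the least orders at which their derivatives leave \<open>J\<close>. In the
  Leibniz expansion of the derivative of \<open>a * b\<close> of order \<open>k + l\<close>, every
  other term has a factor of order below \<open>k\<close> or below \<open>l\<close>, hence in
  \<open>J\<close>. The remaining term carries a binomial coefficient, which is a unit by
  \<open>unit\<close>; this is where characteristic 0 enters.\<close>

theorem prime_ideal_differential_core:
  fixes d :: "'a::comm_ring_1 \<Rightarrow> 'a"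
  assumes add: "\<And>a b. d (a + b) = d a + d b" and mult: "\<And>a b. d (a * b) = d a * b + a * d b"
    and unit: "\<And>n. n > 0 \<Longrightarrow> (of_nat n :: 'a) dvd 1"
    and "prime_ideal J"
  shows "prime_ideal {a. \<forall>k. (d ^^ k) a \<in> J}"
proof -
  interpret prime_ideal J by fact
  note Leibniz = Leibniz_rule[of d, OF add mult]
  have d0: "d 0 = 0" using add[of 0 0] by simp
  have dk0: "(d ^^ k) 0 = 0" for k by (induction k) (auto simp: d0)
  have dkadd: "(d ^^ k) (a + b) = (d ^^ k) a + (d ^^ k) b" for k a b
    by (induction k) (auto simp: add)
  show ?thesis
  proof
    show "0 \<in> {a. \<forall>k. (d ^^ k) a \<in> J}" by (simp add: dk0 zero_mem)
  next
    fix a b assume "a \<in> {a. \<forall>k. (d ^^ k) a \<in> J}" "b \<in> {a. \<forall>k. (d ^^ k) a \<in> J}"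
    then show "a + b \<in> {a. \<forall>k. (d ^^ k) a \<in> J}" by (simp add: dkadd add_mem)
  next
    fix a r assume "a \<in> {a. \<forall>k. (d ^^ k) a \<in> J}"
    then show "r * a \<in> {a. \<forall>k. (d ^^ k) a \<in> J}"
      by (auto simp: Leibniz intro!: sum_mem mult_mem)
  next
    have "(d ^^ 0) 1 \<notin> J" using one_notin by simp
    then show "1 \<notin> {a. \<forall>k. (d ^^ k) a \<in> J}" by blast
  next
    fix a b assume ab: "a * b \<in> {a. \<forall>k. (d ^^ k) a \<in> J}"
    show "a \<in> {a. \<forall>k. (d ^^ k) a \<in> J} \<or> b \<in> {a. \<forall>k. (d ^^ k) a \<in> J}"
    proof (rule ccontr)
      assume "\<not> ?thesis"
      then have ex: "\<exists>k. (d ^^ k) a \<notin> J" "\<exists>k. (d ^^ k) b \<notin> J" by auto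
      define k where "k = (LEAST k. (d ^^ k) a \<notin> J)"
      define l where "l = (LEAST k. (d ^^ k) b \<notin> J)"
      have k: "(d ^^ k) a \<notin> J" "\<And>i. i < k \<Longrightarrow> (d ^^ i) a \<in> J"
        unfolding k_def using LeastI_ex[OF ex(1)] not_less_Least by blast+
      have l: "(d ^^ l) b \<notin> J" "\<And>i. i < l \<Longrightarrow> (d ^^ i) b \<in> J"
        unfolding l_def using LeastI_ex[OF ex(2)] not_less_Least by blast+
      let ?c = "\<lambda>i. of_nat ((k + l) choose i) * ((d ^^ i) a * (d ^^ (k + l - i)) b)"
      have "(d ^^ (k + l)) (a * b) = (\<Sum>i\<le>k + l. ?c i)" by (rule Leibniz)
      also have "\<dots> = ?c k + (\<Sum>i\<in>{..k + l} - {k}. ?c i)"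
        by (subst sum.remove[of _ k]) auto
      finally have "?c k = (d ^^ (k + l)) (a * b) - (\<Sum>i\<in>{..k + l} - {k}. ?c i)" by simp
      also have "\<dots> \<in> J"
      proof (intro diff_mem sum_mem)
        show "(d ^^ (k + l)) (a * b) \<in> J" using ab by blast
        fix i assume i: "i \<in> {..k + l} - {k}"
        then consider "i < k" | "k + l - i < l" by force
        then show "?c i \<in> J"
          by cases (auto intro!: mult_mem[of "_ * _"] intro: mult_mem mult_mem2 k(2) l(2))
      qed
      finally have c: "of_nat ((k + l) choose k) * ((d ^^ k) a * (d ^^ l) b) \<in> J" by simp
      have "(k + l) choose k > 0" by simp
      from unit[OF this] obtain u :: 'a where "of_nat ((k + l) choose k) * u = 1" by (auto simp: dvd_def)
      then have "of_nat ((k + l) choose k) \<notin> J" using one_notin mult_mem2 by metis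
      then show False using c prime k(1) l(1) by metis
    qed
  qed
qed


section \<open>Polynomials in finitely many indeterminates\<close>

text \<open>Any linear order on the indeterminates makes the library's proof that polynomial mappings
  form an integral domain applicable.\<close>

primrec indet_code :: "indet \<Rightarrow> nat" where
  "indet_code Ix = 0"
| "indet_code (Iy j) = 3 * j + 1"
| "indet_code (Iz j) = 3 * j + 2"
| "indet_code (Iw j) = 3 * j + 3"

lemma indet_code_inject: "indet_code u = indet_code v \<Longrightarrow> u = v"
  by (cases u; cases v; simp; presburger)

instantiation indet :: linorder
begin

definition "u \<le> v \<longleftrightarrow> indet_code u \<le> indet_code v"
definition "u < v \<longleftrightarrow> indet_code u < indet_code v"

instance
  by standard (auto simp: less_eq_indet_def less_indet_def intro: indet_code_inject)

end

section \<open>Monomials, total degree and induction over polynomial subrings\<close>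

lemma single_plus_diff:
  fixes t :: "indet \<Rightarrow>\<^sub>0 nat"
  assumes "v \<in> Poly_Mapping.keys t"
  shows "t = (t - Poly_Mapping.single v 1) + Poly_Mapping.single v (1 :: nat)"
proof (rule poly_mapping_eqI)
  fix u
  have "expo t v \<noteq> 0" using assms by (simp add: in_keys_iff)
  then show "expo t u = expo (t - Poly_Mapping.single v 1 + Poly_Mapping.single v 1) u"
    by (auto simp: lookup_add lookup_minus lookup_single when_def)
qed

definition monom_degree :: "(indet \<Rightarrow>\<^sub>0 nat) \<Rightarrow> nat"
  where "monom_degree t = (\<Sum>v\<in>Poly_Mapping.keys t. expo t v)"

lemma monom_degree_superset:
  "finite A \<Longrightarrow> Poly_Mapping.keys t \<subseteq> A \<Longrightarrow> monom_degree t = (\<Sum>v\<in>A. expo t v)"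
  unfolding monom_degree_def by (intro sum.mono_neutral_left) (auto simp: in_keys_iff)

lemma monom_degree_add: "monom_degree (s + t) = monom_degree s + monom_degree t"
proof -
  let ?A = "Poly_Mapping.keys s \<union> Poly_Mapping.keys t"
  have "Poly_Mapping.keys (s + t) \<subseteq> ?A" by (rule Poly_Mapping.keys_add)
  then show ?thesis
    by (simp add: monom_degree_superset[of ?A] lookup_add sum.distrib)
qed

lemma monom_degree_single [simp]: "monom_degree (Poly_Mapping.single v k) = k"
  by (simp add: monom_degree_def)

lemma Var_power: "(Var v :: 'k::comm_ring_1 dpoly) ^ k = Poly_Mapping.single (Poly_Mapping.single v k) 1"
proof (induction k)
  case (Suc k)
  then show ?case by (simp add: Var_def mult_single single_add[symmetric])
qed simp

lemma single_eq_prod_Var: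
  assumes "finite U" "Poly_Mapping.keys t \<subseteq> U"
  shows "(Poly_Mapping.single t 1 :: 'k::comm_ring_1 dpoly) = (\<Prod>v\<in>U. Var v ^ expo t v)"
proof -
  have prod: "(\<Prod>v\<in>U. Var v ^ e v) = (Poly_Mapping.single (\<Sum>v\<in>U. Poly_Mapping.single v (e v)) 1 :: 'k dpoly)"
    for e
    using assms(1) by induction (auto simp: Var_power mult_single)
  have "t = (\<Sum>v\<in>U. Poly_Mapping.single v (expo t v))"
    using assms by (intro poly_mapping_eqI) (auto simp: lookup_sum lookup_single when_def in_keys_iff)
  then show ?thesis by (simp add: prod)
qed

lemma single_eq_Const_mult: "Poly_Mapping.single t a = Const a * (Poly_Mapping.single t 1 :: 'k::comm_ring_1 dpoly)"
  by (simp add: Const_def mult_single)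

lemma polys_in_Const: "Const c \<in> polys_in V"
  by (auto simp: polys_in_def vars_def Const_def)

lemma polys_in_mono: "f \<in> polys_in V \<Longrightarrow> V \<subseteq> W \<Longrightarrow> f \<in> polys_in W"
  by (auto simp: polys_in_def)

lemma polys_in_power: "f \<in> polys_in V \<Longrightarrow> (f :: 'k::comm_ring_1 dpoly) ^ k \<in> polys_in V"
  by (induction k) (auto intro: polys_in_mult)

lemma polys_in_induct [consumes 1, case_names Const Var add mult]:
  fixes f :: "'k::comm_ring_1 dpoly"
  assumes f: "f \<in> polys_in V" and Const: "\<And>c. P (Const c)" and Var: "\<And>v. v \<in> V \<Longrightarrow> P (Var v)"
    and add: "\<And>f g. f \<in> polys_in V \<Longrightarrow> g \<in> polys_in V \<Longrightarrow> P f \<Longrightarrow> P g \<Longrightarrow> P (f + g)"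
    and mult: "\<And>f g. f \<in> polys_in V \<Longrightarrow> g \<in> polys_in V \<Longrightarrow> P f \<Longrightarrow> P g \<Longrightarrow> P (f * g)"
  shows "P f"
proof -
  \<comment> \<open>Membership is carried along because \<open>add\<close> and \<open>mult\<close>
    ask for it at every intermediate sum and product.\<close>
  define Q where "Q f \<longleftrightarrow> f \<in> polys_in V \<and> P f" for f
  have Q0: "Q 0" and Q1: "Q 1" using Const[of 0] Const[of 1] by (auto simp: Q_def)
  have QConst: "Q (Const c)" for c by (simp add: Q_def Const polys_in_Const)
  have Qpow: "Q (Var v ^ k)" if "v \<in> V" for v k
    using that by (induction k) (auto simp: Q1, auto simp: Q_def Var polys_in_Var intro: mult polys_in_mult)
  have Qprod: "Q (\<Prod>v\<in>A. h v)" if "\<And>v. v \<in> A \<Longrightarrow> Q (h v)" for A and h :: "indet \<Rightarrow> _"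
    using that by (induction A rule: infinite_finite_induct) (auto simp: Q1, auto simp: Q_def intro: mult polys_in_mult)
  have Qsum: "Q (\<Sum>v\<in>A. h v)" if "\<And>v. v \<in> A \<Longrightarrow> Q (h v)" for A and h :: "(indet \<Rightarrow>\<^sub>0 nat) \<Rightarrow> _"
    using that by (induction A rule: infinite_finite_induct) (auto simp: Q0, auto simp: Q_def intro: add polys_in_add)
  have "Q (Poly_Mapping.single t a)" if "t \<in> Poly_Mapping.keys f" for t a
  proof -
    have "Poly_Mapping.keys t \<subseteq> V" using f that by (auto simp: polys_in_def vars_def)
    then have "Q (Poly_Mapping.single t 1)"
      by (subst single_eq_prod_Var[of "Poly_Mapping.keys t"]) (auto intro!: Qprod Qpow)
    then show ?thesis
      using QConst[of a] by (subst single_eq_Const_mult) (auto simp: Q_def intro: mult polys_in_mult)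
  qed
  then have "Q f" by (subst dpoly_expand) (rule Qsum)
  then show ?thesis by (simp add: Q_def)
qed

lemma finite_vars [simp]: "finite (vars f)"
  by (simp add: vars_def)

lemma deriv_ext_cong:
  assumes "f \<in> polys_in V" and "\<And>v. v \<in> V \<Longrightarrow> \<delta> v = \<epsilon> v"
  shows "deriv_ext \<delta> f = deriv_ext \<epsilon> f"
  using assms(1) by (induction rule: polys_in_induct) (auto simp: assms(2) deriv_ext_add deriv_ext_mult)

text \<open>In contrast to \<open>polys_in_deriv_ext\<close>, the derivation may leave the ring over
  \<open>V\<close>, as happens when differentiation raises the order by one.\<close>

lemma polys_in_deriv_ext_larger:
  fixes f :: "'k::comm_ring_1 dpoly"
  assumes "f \<in> polys_in V" "V \<subseteq> W" and "\<And>v. v \<in> V \<Longrightarrow> \<delta> v \<in> polys_in W"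
  shows "deriv_ext \<delta> f \<in> polys_in W"
  using assms(1)
  by (induction rule: polys_in_induct)
     (use assms in \<open>auto simp: deriv_ext_add deriv_ext_mult
        intro!: polys_in_add polys_in_mult elim: polys_in_mono\<close>)

section \<open>Partial derivatives\<close>

definition partial :: "indet \<Rightarrow> 'k::comm_ring_1 dpoly \<Rightarrow> 'k dpoly"
  where "partial v = deriv_ext (\<lambda>u. if u = v then 1 else 0)"

text \<open>Both sides are additive, satisfy the product rule, kill constants and agree on the
  indeterminates in \<open>V\<close>.\<close>

lemma deriv_ext_eq_sum_partial:
  assumes "finite V" "f \<in> polys_in V"
  shows "deriv_ext \<delta> f = (\<Sum>v\<in>V. partial v f * \<delta> v)"
  using assms(2)
proof (induction rule: polys_in_induct)
  case (Var u)
  have "(\<Sum>v\<in>V. (if u = v then 1 else 0) * \<delta> v) = (\<Sum>v\<in>V. if u = v then \<delta> v else 0)"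
    by (intro sum.cong) auto
  then show ?case using Var assms(1) by (simp add: partial_def)
qed (auto simp: partial_def deriv_ext_add deriv_ext_mult algebra_simps sum.distrib sum_distrib_left)

lemma coef_partial:
  "coef (partial v f) s = of_nat (expo s v + 1) * coef f (s + Poly_Mapping.single v 1)"
proof (induction f rule: dpoly_induct)
  case (single t a)
  let ?e = "Poly_Mapping.single v (1 :: nat)"
  have "partial v (Poly_Mapping.single t a)
      = Const a * (\<Sum>u\<in>Poly_Mapping.keys t. if u = v then of_nat (expo t u) * Poly_Mapping.single (t - Poly_Mapping.single u 1) 1 else 0)"
    unfolding partial_def deriv_ext_def lin_ext_single
    by (intro arg_cong2[of _ _ _ _ "(*)"] sum.cong) auto
  also have "\<dots> = Const a * (of_nat (expo t v) * Poly_Mapping.single (t - ?e) 1)"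
    by (auto simp: in_keys_iff)
  also have "\<dots> = Poly_Mapping.single (t - ?e) (of_nat (expo t v) * a)"
    by (simp add: Const_def mult_single mult.commute flip: single_of_nat)
  finally have *: "partial v (Poly_Mapping.single t a) = \<dots>" .
  show ?case
  proof (cases "v \<in> Poly_Mapping.keys t")
    case True
    have "t - ?e = s \<longleftrightarrow> t = s + ?e"
      using single_plus_diff[OF True] by auto
    then show ?thesis unfolding * by (auto simp: lookup_single when_def lookup_add)
  next
    case False
    then have "t \<noteq> s + ?e" by (auto simp: in_keys_iff lookup_add)
    then show ?thesis using False unfolding * by (auto simp: lookup_single when_def in_keys_iff)
  qed
qed (auto simp: partial_def deriv_ext_add lookup_add algebra_simps)

text \<open>The factor \<open>expo s v + 1\<close> is non-zero in characteristic 0, so no monomial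
  containing \<open>v\<close> is lost under differentiation.\<close>

lemma keys_partial:
  fixes f :: "'k::field_char_0 dpoly"
  shows "s \<in> Poly_Mapping.keys (partial v f) \<longleftrightarrow> s + Poly_Mapping.single v 1 \<in> Poly_Mapping.keys f"
proof -
  have "(of_nat (expo s v + 1) :: 'k) \<noteq> 0" using of_nat_neq_0[of "expo s v", where ?'a = 'k] by simp
  then show ?thesis by (simp add: in_keys_iff coef_partial)
qed

lemma partial_nonzero:
  fixes f :: "'k::field_char_0 dpoly"
  assumes "v \<in> vars f"
  shows "partial v f \<noteq> 0"
proof -
  obtain t where "t \<in> Poly_Mapping.keys f" "v \<in> Poly_Mapping.keys t"
    using assms by (auto simp: vars_def)
  then have "t - Poly_Mapping.single v 1 \<in> Poly_Mapping.keys (partial v f)"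
    using single_plus_diff[of v t] by (simp add: keys_partial)
  then show ?thesis by auto
qed

lemma polys_in_partial: "f \<in> polys_in V \<Longrightarrow> partial v f \<in> polys_in V"
  unfolding partial_def by (rule polys_in_deriv_ext) auto


section \<open>Algebraic dependence modulo a prime ideal\<close>

text \<open>\<open>rational_over J s W\<close>: the polynomials whose class modulo \<open>J\<close> lies in the localization
  $K[W]_s$.\<close>

definition rational_over :: "'k::comm_ring_1 dpoly set \<Rightarrow> 'k dpoly \<Rightarrow> indet set \<Rightarrow> 'k dpoly set"
  where "rational_over J s W = {a. \<exists>e. \<exists>b\<in>polys_in W. s ^ e * a - b \<in> J}"

lemma rational_overI:
  "s ^ e * a - b \<in> J \<Longrightarrow> b \<in> polys_in W \<Longrightarrow> a \<in> rational_over J s W"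
  by (auto simp: rational_over_def)

lemma rational_overE:
  assumes "a \<in> rational_over J s W"
  obtains e b where "s ^ e * a - b \<in> J" "b \<in> polys_in W"
  using assms by (auto simp: rational_over_def)

locale prime_dpoly_ideal = prime_ideal J for J :: "'k::field_char_0 dpoly set"
begin

lemma rational_over_polys_in: "a \<in> polys_in W \<Longrightarrow> a \<in> rational_over J s W"
  by (rule rational_overI[of _ 0 _ a]) (simp_all add: zero_mem)

lemma rational_over_ideal: "a \<in> J \<Longrightarrow> a \<in> rational_over J s W"
  by (rule rational_overI[of _ 0 _ 0]) simp_all

text \<open>The denominator \<open>s\<close> is invertible in the localization: one more power of
  \<open>s\<close> clears it.\<close>

lemma rational_over_cancel: "s * a \<in> rational_over J s W \<Longrightarrow> a \<in> rational_over J s W"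
  by (erule rational_overE, rule rational_overI[of _ "Suc _"]) (simp_all add: mult_ac)

lemma rational_over_add:
  assumes s: "s \<in> polys_in W" and a: "a \<in> rational_over J s W" and b: "b \<in> rational_over J s W"
  shows "a + b \<in> rational_over J s W"
proof -
  obtain e a' where 1: "s ^ e * a - a' \<in> J" "a' \<in> polys_in W" using a by (rule rational_overE)
  obtain f b' where 2: "s ^ f * b - b' \<in> J" "b' \<in> polys_in W" using b by (rule rational_overE)
  have "s ^ (e + f) * (a + b) - (s ^ f * a' + s ^ e * b')
      = s ^ f * (s ^ e * a - a') + s ^ e * (s ^ f * b - b')"
    by (simp add: power_add algebra_simps)
  also have "\<dots> \<in> J" by (intro add_mem mult_mem 1 2)
  finally show ?thesis
    by (rule rational_overI) (intro polys_in_add polys_in_mult polys_in_power s 1 2)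
qed

lemma rational_over_mult:
  assumes a: "a \<in> rational_over J s W" and b: "b \<in> rational_over J s W"
  shows "a * b \<in> rational_over J s W"
proof -
  obtain e a' where 1: "s ^ e * a - a' \<in> J" "a' \<in> polys_in W" using a by (rule rational_overE)
  obtain f b' where 2: "s ^ f * b - b' \<in> J" "b' \<in> polys_in W" using b by (rule rational_overE)
  have "s ^ (e + f) * (a * b) - a' * b' = (s ^ e * a) * (s ^ f * b) - a' * b'"
    by (simp add: power_add algebra_simps)
  also have "\<dots> \<in> J" by (intro cong_mult 1 2)
  finally show ?thesis by (rule rational_overI) (intro polys_in_mult 1 2)
qed

lemma rational_over_minus: "a \<in> rational_over J s W \<Longrightarrow> - a \<in> rational_over J s W"
  using rational_over_mult[OF rational_over_polys_in[OF polys_in_Const[of "-1"]], of a s W]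
  by (simp add: Const_def single_uminus)

lemma rational_over_diff:
  "s \<in> polys_in W \<Longrightarrow> a \<in> rational_over J s W \<Longrightarrow> b \<in> rational_over J s W
    \<Longrightarrow> a - b \<in> rational_over J s W"
  using rational_over_add[OF _ _ rational_over_minus, of s W a b] by simp

lemma rational_over_polys:
  assumes "s \<in> polys_in W" and "\<And>v. v \<in> V \<Longrightarrow> Var v \<in> rational_over J s W" and "f \<in> polys_in V"
  shows "f \<in> rational_over J s W"
  using assms(3)
  by (induction rule: polys_in_induct)
     (auto intro: assms rational_over_add rational_over_mult rational_over_polys_in polys_in_Const)

text \<open>Serves to merge two localizations, with different denominators and generators, into one
  with the product as denominator.\<close>

lemma rational_over_mono:
  assumes a: "a \<in> rational_over J s W" and "W \<subseteq> W'" and s': "s' \<in> polys_in W'"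
  shows "a \<in> rational_over J (s * s') W'"
proof -
  obtain e b where 1: "s ^ e * a - b \<in> J" "b \<in> polys_in W" using a by (rule rational_overE)
  have "(s * s') ^ e * a - s' ^ e * b = s' ^ e * (s ^ e * a - b)"
    by (simp add: power_mult_distrib algebra_simps)
  also have "\<dots> \<in> J" by (intro mult_mem 1)
  finally show ?thesis
    by (rule rational_overI) (intro polys_in_mult polys_in_power s' polys_in_mono[OF 1(2) \<open>W \<subseteq> W'\<close>])
qed

lemma Const_notin: "c \<noteq> 0 \<Longrightarrow> Const c \<notin> J"
proof
  assume "c \<noteq> 0" "Const c \<in> J"
  then have "Const (inverse c) * Const c \<in> J" by (intro mult_mem)
  then show False using \<open>c \<noteq> 0\<close> one_notin by (simp flip: Const_mult)
qed

text \<open>An element of least degree among the non-zero elements of \<open>J\<close> in $K[u, v_0, v_1, \ldots]$ has a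
  separant outside \<open>J\<close>; differentiating it expresses all later \<open>v j\<close> rationally.\<close>

lemma differential_relation_rational:
  fixes \<delta> :: "indet \<Rightarrow> 'k dpoly" and u :: indet and v :: "nat \<Rightarrow> indet"
  assumes inj: "inj v" and u: "u \<notin> range v"
    and \<delta>u: "\<delta> u = 1" and \<delta>v: "\<And>j. \<delta> (v j) = Var (v (Suc j))"
    and stable: "\<And>a. a \<in> J \<Longrightarrow> a \<in> polys_in ({u} \<union> range v) \<Longrightarrow> deriv_ext \<delta> a \<in> J"
    and ex: "f \<in> J" "f \<in> polys_in ({u} \<union> range v)" "f \<noteq> 0"
  shows "\<exists>s N. s \<in> polys_in ({u} \<union> v ` {..N}) \<and> s \<notin> J \<and>
    (\<forall>j. Var (v j) \<in> rational_over J s ({u} \<union> v ` {..N}))"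
proof -
  let ?V = "{u} \<union> range v"
  let ?d = "deriv_ext \<delta>"
  \<comment> \<open>\<open>below a d\<close> bounds the total degree of \<open>a\<close>; the least
    \<open>d\<close> with \<open>P d\<close> gives a relation \<open>q\<close> of minimal
    degree.\<close>
  define below where "below a d \<longleftrightarrow> (\<forall>t\<in>Poly_Mapping.keys a. monom_degree t \<le> d)"
    for a :: "'k dpoly" and d
  define P where "P d \<longleftrightarrow> (\<exists>a. a \<in> J \<and> a \<in> polys_in ?V \<and> a \<noteq> 0 \<and> below a d)" for d
  have "\<exists>d. P d"
  proof
    have "below f (Max (monom_degree ` Poly_Mapping.keys f))" by (simp add: below_def)
    then show "P (Max (monom_degree ` Poly_Mapping.keys f))" using ex by (auto simp: P_def)
  qed
  then have "P (LEAST d. P d)" by (rule LeastI_ex)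
  then obtain q where q: "q \<in> J" "q \<in> polys_in ?V" "q \<noteq> 0" "below q (LEAST d. P d)"
    by (auto simp: P_def)
  \<comment> \<open>The derivative by an indeterminate that occurs is non-zero in characteristic 0
    and has smaller total degree, so minimality keeps it out of \<open>J\<close>.\<close>
  have separant: "partial w q \<notin> J" if w: "w \<in> vars q" for w
  proof
    assume J: "partial w q \<in> J"
    obtain t where t: "t \<in> Poly_Mapping.keys q" "w \<in> Poly_Mapping.keys t"
      using w by (auto simp: vars_def)
    have deg: "Suc (monom_degree s) \<le> (LEAST d. P d)" if "s \<in> Poly_Mapping.keys (partial w q)" for s
      using q(4) that by (auto simp: keys_partial below_def monom_degree_add)
    obtain s where "s \<in> Poly_Mapping.keys (partial w q)"
      using partial_nonzero[OF w] by (metis keys_eq_empty ex_in_conv)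
    from deg[OF this] obtain d where d: "(LEAST d. P d) = Suc d" by (cases "LEAST d. P d") auto
    have "below (partial w q) d" using deg by (auto simp: below_def d)
    then have "P d"
      using J polys_in_partial[OF q(2)] partial_nonzero[OF w] by (auto simp: P_def)
    then show False using not_less_Least[of d P] d by simp
  qed
  \<comment> \<open>If at most \<open>u\<close> occurred, then \<open>?d q = partial u q\<close>
    would be in \<open>J\<close> by stability. By \<open>separant\<close> not even \<open>u\<close>
    would occur, leaving a non-zero constant in the proper ideal \<open>J\<close>.\<close>
  have "\<exists>j. v j \<in> vars q"
  proof (rule ccontr)
    assume no: "\<nexists>j. v j \<in> vars q"
    then have vq: "vars q \<subseteq> {u}" using q(2) by (auto simp: polys_in_def)
    have "?d q = partial u q"
      using deriv_ext_eq_sum_partial[of "{u}" q \<delta>] vq by (simp add: polys_in_def \<delta>u)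
    then have "partial u q \<in> J" using stable q(1,2) by metis
    then have "vars q = {}" using separant vq by blast
    then have "Poly_Mapping.keys q \<subseteq> {0}" by (auto simp: vars_def)
    then have "q = Const (coef q 0)"
      by (intro poly_mapping_eqI) (auto simp: Const_def lookup_single when_def in_keys_iff)
    then show False using q(1,3) Const_notin by (metis Const_0)
  qed
  moreover have fin: "finite {j. v j \<in> vars q}"
    using finite_vimageI[OF finite_vars inj] by (simp add: vimage_def)
  ultimately obtain N where N: "v N \<in> vars q" "\<And>j. v j \<in> vars q \<Longrightarrow> j \<le> N"
    using Max_in[OF fin] Max_ge[OF fin] by blast
  \<comment> \<open>With the strict bound, one derivation raises the index \<open>k\<close> by at
    most one, and \<open>W (Suc N)\<close> contains all indeterminates of \<open>q\<close>.\<close>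
  define W where "W k = {u} \<union> v ` {..<k}" for k
  define s where "s = partial (v N) q"
  have W_mono: "W k \<subseteq> W l" if "k \<le> l" for k l using that by (auto simp: W_def)
  have WN: "{u} \<union> v ` {..N} = W (Suc N)" by (auto simp: W_def lessThan_Suc_atMost)
  have qW: "q \<in> polys_in (W (Suc N))"
    using q(2) N(2) by (fastforce simp: polys_in_def W_def)
  have s: "s \<in> polys_in (W (Suc N))" "s \<notin> J"
    using qW separant[OF N(1)] by (auto simp: s_def polys_in_partial)
  have d_in: "?d a \<in> polys_in (W (Suc k))" if "a \<in> polys_in (W k)" for a k
    using that
    by (rule polys_in_deriv_ext_larger)
       (auto simp: W_def \<delta>u \<delta>v intro!: polys_in_Var)
  \<comment> \<open>Each derivative of \<open>q\<close> is linear in its highest indeterminate,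
    always with the same leading coefficient \<open>s\<close>: differentiating
    \<open>s * Var (v j) + r\<close>, with \<open>s\<close> and \<open>r\<close> of lower order,
    produces the new indeterminate only from \<open>v j\<close>.\<close>
  have prolong: "\<exists>r. r \<in> polys_in (W (Suc (N + k))) \<and> (?d ^^ Suc k) q = s * Var (v (Suc (N + k))) + r" for k
  proof (induction k)
    case 0
    have vN: "v N \<in> W (Suc N)" by (simp add: W_def)
    have "?d q = (\<Sum>w\<in>W (Suc N). partial w q * \<delta> w)"
      using qW by (intro deriv_ext_eq_sum_partial) (simp add: W_def)
    also have "\<dots> = s * Var (v (Suc N)) + (\<Sum>w\<in>W (Suc N) - {v N}. partial w q * \<delta> w)"
      using vN by (subst sum.remove[of _ "v N"]) (auto simp: W_def s_def \<delta>v)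
    finally have "?d q = \<dots>" .
    \<comment> \<open>With \<open>v N\<close> removed, the values of \<open>\<delta>\<close> reach
      at most \<open>v N\<close>, so no new indeterminate appears.\<close>
    moreover have "(\<Sum>w\<in>W (Suc N) - {v N}. partial w q * \<delta> w) \<in> polys_in (W (Suc N))"
    proof (intro polys_in_sum polys_in_mult polys_in_partial qW)
      fix w assume "w \<in> W (Suc N) - {v N}"
      then consider "w = u" | j where "w = v j" "j < N"
        by (auto simp: W_def less_Suc_eq)
      then show "\<delta> w \<in> polys_in (W (Suc N))"
        by cases (auto simp: \<delta>u \<delta>v W_def intro!: polys_in_Var)
    qed
    ultimately show ?case by auto
  next
    case (Suc k)
    then obtain r where r: "r \<in> polys_in (W (Suc (N + k)))"
      "(?d ^^ Suc k) q = s * Var (v (Suc (N + k))) + r" by auto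
    have "(?d ^^ Suc (Suc k)) q = s * Var (v (Suc (N + Suc k)))
        + (?d s * Var (v (Suc (N + k))) + ?d r)"
      using r(2) by (simp add: deriv_ext_add deriv_ext_mult \<delta>v algebra_simps)
    moreover have "?d s * Var (v (Suc (N + k))) + ?d r \<in> polys_in (W (Suc (N + Suc k)))"
    proof (intro polys_in_add polys_in_mult)
      show "?d s \<in> polys_in (W (Suc (N + Suc k)))"
        using d_in[OF s(1)] by (rule polys_in_mono) (rule W_mono, simp)
      show "(Var (v (Suc (N + k))) :: 'k dpoly) \<in> polys_in (W (Suc (N + Suc k)))"
        by (intro polys_in_Var) (auto simp: W_def)
      show "?d r \<in> polys_in (W (Suc (N + Suc k)))" using d_in[OF r(1)] by simp
    qed
    ultimately show ?case by blast
  qed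
  have dq: "(?d ^^ k) q \<in> J \<and> (?d ^^ k) q \<in> polys_in ?V" for k
  proof (induction k)
    case (Suc k)
    moreover have "deriv_ext \<delta> a \<in> polys_in ?V" if "a \<in> polys_in ?V" for a
      using that by (rule polys_in_deriv_ext) (auto simp: \<delta>u \<delta>v intro!: polys_in_Var)
    ultimately show ?case using stable by auto
  qed (use q in auto)
  have "Var (v j) \<in> rational_over J s (W (Suc N))" for j
  proof (induction j rule: less_induct)
    case (less j)
    show ?case
    proof (cases "j \<le> N")
      case True
      then show ?thesis by (intro rational_over_polys_in polys_in_Var) (auto simp: W_def)
    next
      case False
      then obtain k where k: "j = Suc (N + k)"
        by (metis not_less less_iff_Suc_add linorder_not_le)
      \<comment> \<open>This derivative of \<open>q\<close> lies in \<open>J\<close>, so modulo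
        \<open>J\<close> it can be solved for \<open>v j\<close> after inverting \<open>s\<close>.
        The remainder \<open>r\<close> involves only \<open>u\<close> and earlier
        \<open>v i\<close>, covered by the induction hypothesis.\<close>
      obtain r where r: "r \<in> polys_in (W j)" "(?d ^^ Suc k) q = s * Var (v j) + r"
        using prolong[of k] by (auto simp: k)
      have "r \<in> rational_over J s (W (Suc N))"
      proof (rule rational_over_polys[OF s(1) _ r(1)])
        fix w assume "w \<in> W j"
        then consider "w = u" | i where "w = v i" "i < j" by (auto simp: W_def)
        then show "Var w \<in> rational_over J s (W (Suc N))"
        proof cases
          case 1
          then show ?thesis by (intro rational_over_polys_in polys_in_Var) (simp add: W_def)
        qed (simp add: less.IH)
      qed
      moreover have "s * Var (v j) = (?d ^^ Suc k) q - r" using r(2) by simp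
      moreover have "(?d ^^ Suc k) q \<in> rational_over J s (W (Suc N))"
        using dq by (blast intro: rational_over_ideal)
      ultimately show ?thesis
        using rational_over_diff[OF s(1)] rational_over_cancel by metis
    qed
  qed
  then show ?thesis using s unfolding WN[symmetric] by blast
qed

end


section \<open>Algebraic dependence by counting monomials\<close>

text \<open>The vectors form a family because \<open>g\<close> may repeat values. A repeated value
  gives the relation \<open>g s - g t = 0\<close>; if \<open>g\<close> is injective, its image is
  too large to be independent in the span of \<open>B\<close>.\<close>

lemma (in vector_space) linear_relation_if_card_less:
  assumes "finite T" "finite B" "card B < card T" and span: "\<And>t. t \<in> T \<Longrightarrow> g t \<in> span B"
  shows "\<exists>c. (\<exists>t\<in>T. c t \<noteq> 0) \<and> (\<Sum>t\<in>T. c t *s g t) = 0"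
proof (cases "inj_on g T")
  case True
  have "dependent (g ` T)"
  proof (rule ccontr)
    assume "independent (g ` T)"
    then have "card (g ` T) \<le> card B"
      using independent_span_bound[of B "g ` T"] assms by auto
    then show False using assms(3) by (simp add: card_image True)
  qed
  then obtain c where c: "\<exists>x\<in>g ` T. c x \<noteq> 0" "(\<Sum>x\<in>g ` T. c x *s x) = 0"
    using dependent_finite[of "g ` T"] assms(1) by auto
  then have "(\<exists>t\<in>T. c (g t) \<noteq> 0) \<and> (\<Sum>t\<in>T. c (g t) *s g t) = 0"
    by (simp add: sum.reindex[OF True])
  then show ?thesis by (intro exI[of _ "\<lambda>t. c (g t)"])
next
  case False
  then obtain s t where st: "s \<in> T" "t \<in> T" "s \<noteq> t" "g s = g t"
    by (auto simp: inj_on_def)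
  define c :: "_ \<Rightarrow> 'a" where "c x = (if x = s then 1 else if x = t then -1 else 0)" for x
  have "(\<Sum>x\<in>T. c x *s g x) = (\<Sum>x\<in>{s, t}. c x *s g x)"
    using assms(1) st by (intro sum.mono_neutral_right) (auto simp: c_def)
  also have "\<dots> = 0" using st by (simp add: c_def)
  finally show ?thesis using st(1) by (intro exI[of _ c]) (auto simp: c_def)
qed

lemma vector_space_dpoly: "vector_space (\<lambda>c (f :: 'k::field dpoly). Const c * f)"
  by unfold_locales (auto simp: algebra_simps Const_add Const_mult)

text \<open>Each exponent is bounded separately, not the total degree, so that the number of
  monomials is exactly a power of \<open>Suc d\<close>.\<close>

definition monom_box :: "indet set \<Rightarrow> nat \<Rightarrow> (indet \<Rightarrow>\<^sub>0 nat) set"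
  where "monom_box U d = {t. Poly_Mapping.keys t \<subseteq> U \<and> (\<forall>v. expo t v \<le> d)}"

lemma bij_betw_monom_box:
  assumes "finite U"
  shows "bij_betw (\<lambda>t. restrict (expo t) U) (monom_box U d) (PiE U (\<lambda>_. {..d}))"
proof (rule bij_betwI')
  fix s t assume st: "s \<in> monom_box U d" "t \<in> monom_box U d"
  show "(restrict (expo s) U = restrict (expo t) U) \<longleftrightarrow> s = t"
  proof
    assume eq: "restrict (expo s) U = restrict (expo t) U"
    show "s = t"
    proof (rule poly_mapping_eqI)
      fix v
      show "expo s v = expo t v"
      proof (cases "v \<in> U")
        case True
        then show ?thesis using fun_cong[OF eq, of v] by simp
      next
        case False
        then have "v \<notin> Poly_Mapping.keys s" "v \<notin> Poly_Mapping.keys t"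
          using st by (auto simp: monom_box_def)
        then show ?thesis by (simp add: in_keys_iff)
      qed
    qed
  qed simp
next
  fix t assume "t \<in> monom_box U d"
  then show "restrict (expo t) U \<in> PiE U (\<lambda>_. {..d})" by (auto simp: monom_box_def)
next
  fix h assume h: "h \<in> PiE U (\<lambda>_. {..d})"
  let ?t = "\<Sum>v\<in>U. Poly_Mapping.single v (h v)"
  have expo: "expo ?t v = (if v \<in> U then h v else 0)" for v
    using assms by (simp add: lookup_sum lookup_single when_def)
  have t: "?t \<in> monom_box U d"
    using h by (auto simp: monom_box_def expo in_keys_iff split: if_splits)
  have "restrict (expo ?t) U = h"
    using h by (auto simp: fun_eq_iff expo PiE_def extensional_def)
  then show "\<exists>t\<in>monom_box U d. h = restrict (expo t) U"
    by (rule bexI[OF sym t])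
qed

lemma finite_monom_box: "finite U \<Longrightarrow> finite (monom_box U d)"
  using bij_betw_finite[OF bij_betw_monom_box, of U d] finite_PiE[of U "\<lambda>_. {..d}"] by simp

lemma card_monom_box: "finite U \<Longrightarrow> card (monom_box U d) = Suc d ^ card U"
  using bij_betw_same_card[OF bij_betw_monom_box, of U d] by (simp add: card_PiE)

lemma monom_box_mono: "c \<le> d \<Longrightarrow> monom_box W c \<subseteq> monom_box W d"
  by (auto simp: monom_box_def intro: order_trans)

section \<open>Polynomials with bounded exponents\<close>

definition polys_box :: "indet set \<Rightarrow> nat \<Rightarrow> 'k::zero dpoly set"
  where "polys_box W c = {f. Poly_Mapping.keys f \<subseteq> monom_box W c}"

lemma polys_box_mono: "f \<in> polys_box W c \<Longrightarrow> c \<le> d \<Longrightarrow> f \<in> polys_box W d"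
  using monom_box_mono[of c d W] by (auto simp: polys_box_def)

lemma polys_box_1: "(1 :: 'k::comm_ring_1 dpoly) \<in> polys_box W c"
  by (auto simp: polys_box_def monom_box_def)

lemma polys_box_mult:
  fixes f g :: "'k::comm_ring_1 dpoly"
  assumes "f \<in> polys_box W c" "g \<in> polys_box W d"
  shows "f * g \<in> polys_box W (c + d)"
proof -
  have "t \<in> monom_box W (c + d)" if "t \<in> Poly_Mapping.keys (f * g)" for t
  proof -
    from that obtain a b where t: "t = a + b" "a \<in> Poly_Mapping.keys f" "b \<in> Poly_Mapping.keys g"
      using keys_mult[of f g] by blast
    then have "a \<in> monom_box W c" "b \<in> monom_box W d" using assms by (auto simp: polys_box_def)
    then show ?thesis
      unfolding t(1) using Poly_Mapping.keys_add[of a b]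
      by (auto simp: monom_box_def lookup_add intro: add_mono)
  qed
  then show ?thesis by (auto simp: polys_box_def)
qed

lemma polys_box_power: "f \<in> polys_box W c \<Longrightarrow> (f :: 'k::comm_ring_1 dpoly) ^ k \<in> polys_box W (c * k)"
proof (induction k)
  case (Suc k)
  then show ?case using polys_box_mult[of f W c "f ^ k" "c * k"] by simp
qed (simp add: polys_box_1)

lemma polys_box_prod:
  fixes h :: "indet \<Rightarrow> 'k::comm_ring_1 dpoly"
  assumes "\<And>u. u \<in> U \<Longrightarrow> h u \<in> polys_box W c"
  shows "prod h U \<in> polys_box W (c * card U)"
  using assms
proof (induction U rule: infinite_finite_induct)
  case (insert u U)
  then show ?case using polys_box_mult[of "h u" W c "prod h U" "c * card U"] by simp
qed (simp_all add: polys_box_1)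

lemma ex_polys_box:
  assumes "f \<in> polys_in W"
  shows "\<exists>c. f \<in> polys_box W c"
proof -
  \<comment> \<open>The largest total degree bounds every exponent; the inserted 0 covers
    \<open>f = 0\<close>, where there are no monomials.\<close>
  define c where "c = Max (insert 0 (monom_degree ` Poly_Mapping.keys f))"
  have "t \<in> monom_box W c" if t: "t \<in> Poly_Mapping.keys f" for t
  proof -
    have "expo t v \<le> monom_degree t" for v
      by (cases "v \<in> Poly_Mapping.keys t")
         (auto simp: monom_degree_def in_keys_iff intro: member_le_sum)
    moreover have "monom_degree t \<le> c" using t by (simp add: c_def)
    ultimately show ?thesis
      using assms t by (auto simp: monom_box_def polys_in_def vars_def intro: order_trans)
  qed
  then show ?thesis by (auto simp: polys_box_def)
qed

lemma polys_box_in_span: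
  fixes f :: "'k::field dpoly"
  assumes "f \<in> polys_box W c"
  shows "f \<in> module.span (\<lambda>c (f :: 'k dpoly). Const c * f) ((\<lambda>t. Poly_Mapping.single t 1) ` monom_box W c)"
proof -
  interpret vector_space "\<lambda>c (f :: 'k dpoly). Const c * f" by (rule vector_space_dpoly)
  have "(\<Sum>t\<in>Poly_Mapping.keys f. Const (coef f t) * Poly_Mapping.single t 1)
      \<in> span ((\<lambda>t. Poly_Mapping.single t 1) ` monom_box W c)"
    using assms by (intro span_sum span_scale span_base) (auto simp: polys_box_def)
  then show ?thesis
    by (subst dpoly_expand) (simp flip: single_eq_Const_mult)
qed

text \<open>The two sides grow like powers of \<open>d\<close> with exponents \<open>k < r\<close>.
  The choice \<open>d = Suc C ^ k\<close> suffices, because \<open>Suc (C * d)\<close> is at most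
  \<open>Suc C * Suc d\<close> and the constant \<open>Suc C ^ k = d\<close> is then absorbed by one
  extra factor \<open>Suc d\<close>.\<close>

lemma card_monom_box_growth:
  fixes k r C :: nat
  assumes "k < r"
  shows "\<exists>d. Suc (C * d) ^ k < Suc d ^ r"
proof
  let ?d = "Suc C ^ k"
  have "Suc (C * ?d) \<le> Suc C * Suc ?d" by simp
  then have "Suc (C * ?d) ^ k \<le> (Suc C * Suc ?d) ^ k" by (rule power_mono) simp
  also have "\<dots> = ?d * Suc ?d ^ k" by (simp only: power_mult_distrib)
  also have "\<dots> < Suc ?d * Suc ?d ^ k" by simp
  also have "\<dots> = Suc ?d ^ Suc k" by simp
  also have "\<dots> \<le> Suc ?d ^ r" using assms by (intro power_increasing) auto
  finally show "Suc (C * ?d) ^ k < Suc ?d ^ r" .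
qed

context prime_dpoly_ideal
begin

text \<open>The $(d+1)^{|U|}$ monomials over \<open>U\<close> with exponents at most $d$, multiplied by a common power
  of \<open>s\<close>, are congruent to polynomials over \<open>W\<close> with exponents $O(d)$, a space of dimension
  $O(d^{|W|})$.\<close>

theorem algebraic_relation_if_card_less:
  assumes U: "finite U" and W: "finite W" and card: "card W < card U"
    and s: "s \<in> polys_in W" "s \<notin> J"
    and rational: "\<And>u. u \<in> U \<Longrightarrow> Var u \<in> rational_over J s W"
  shows "\<exists>f. f \<in> J \<and> f \<in> polys_in U \<and> f \<noteq> 0"
proof -
  have "\<forall>u\<in>U. \<exists>e b. s ^ e * Var u - b \<in> J \<and> b \<in> polys_in W"
    using rational by (metis rational_overE)
  then obtain e b where eb: "s ^ e u * Var u - b u \<in> J" "b u \<in> polys_in W" if "u \<in> U" for u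
    by metis
  \<comment> \<open>The sum bounds every \<open>e u\<close>, so the single denominator
    \<open>\<sigma>\<close> serves all indeterminates in \<open>U\<close>.\<close>
  define m where "m = sum e U"
  define \<sigma> where "\<sigma> = s ^ m"
  define b' where "b' u = s ^ (m - e u) * b u" for u
  have \<sigma>: "\<sigma> \<in> polys_in W" using s by (simp add: \<sigma>_def polys_in_power)
  have b': "b' u \<in> polys_in W" "\<sigma> * Var u - b' u \<in> J" if "u \<in> U" for u
  proof -
    show "b' u \<in> polys_in W" using s(1) eb(2)[OF that] by (simp add: b'_def polys_in_mult polys_in_power)
    have "e u \<le> m" unfolding m_def using U that by (intro member_le_sum) auto
    then have "\<sigma> * Var u - b' u = s ^ (m - e u) * (s ^ e u * Var u - b u)"
      by (simp add: \<sigma>_def b'_def right_diff_distrib mult.assoc[symmetric] flip: power_add)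
    then show "\<sigma> * Var u - b' u \<in> J" using eb(1)[OF that] by (simp add: mult_mem)
  qed
  have "\<forall>u\<in>U. \<exists>c. b' u \<in> polys_box W c" using b'(1) ex_polys_box by blast
  then obtain cb where cb: "b' u \<in> polys_box W (cb u)" if "u \<in> U" for u by metis
  obtain c0 where c0: "\<sigma> \<in> polys_box W c0" using ex_polys_box[OF \<sigma>] by blast
  define c where "c = c0 + sum cb U"
  have c\<sigma>: "\<sigma> \<in> polys_box W c" using c0 by (rule polys_box_mono) (simp add: c_def)
  have cb': "b' u \<in> polys_box W c" if "u \<in> U" for u
  proof (rule polys_box_mono[OF cb[OF that]])
    have "cb u \<le> sum cb U" using U that by (intro member_le_sum) auto
    then show "cb u \<le> c" by (simp add: c_def)
  qed
  obtain d where d: "Suc ((c * card U) * d) ^ card W < Suc d ^ card U"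
    using card_monom_box_growth[OF card] by blast
  \<comment> \<open>The padding by powers of \<open>\<sigma>\<close> makes the total multiplier
    \<open>\<sigma> ^ (d * card U)\<close> the same for all monomials, so that a linear relation
    among the \<open>g t\<close> can be transferred back to them.\<close>
  define g where "g t = (\<Prod>u\<in>U. b' u ^ expo t u * \<sigma> ^ (d - expo t u))" for t
  have g_box: "g t \<in> polys_box W (c * card U * d)" if t: "t \<in> monom_box U d" for t
  proof -
    have "b' u ^ expo t u * \<sigma> ^ (d - expo t u) \<in> polys_box W (c * d)" if "u \<in> U" for u
    proof -
      have "expo t u \<le> d" using t by (simp add: monom_box_def)
      then have "c * expo t u + c * (d - expo t u) = c * d"
        by (simp flip: distrib_left)
      then show ?thesis
        using polys_box_mult[OF polys_box_power[OF cb'[OF that]] polys_box_power[OF c\<sigma>]] by metis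
    qed
    then have "g t \<in> polys_box W (c * d * card U)" unfolding g_def by (rule polys_box_prod)
    then show ?thesis by (simp add: mult_ac)
  qed
  have g_cong: "\<sigma> ^ (d * card U) * Poly_Mapping.single t 1 - g t \<in> J" if t: "t \<in> monom_box U d" for t
  proof -
    have "\<sigma> ^ (d * card U) * Poly_Mapping.single t 1 = (\<Prod>u\<in>U. \<sigma> ^ d * Var u ^ expo t u)"
      using t U by (subst single_eq_prod_Var[of U])
        (auto simp: monom_box_def prod.distrib power_mult)
    also have "\<dots> = (\<Prod>u\<in>U. (\<sigma> * Var u) ^ expo t u * \<sigma> ^ (d - expo t u))"
    proof (rule prod.cong[OF refl])
      fix u
      have "expo t u \<le> d" using t by (simp add: monom_box_def)
      then have "\<sigma> ^ d = \<sigma> ^ expo t u * \<sigma> ^ (d - expo t u)" by (simp flip: power_add)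
      then show "\<sigma> ^ d * Var u ^ expo t u = (\<sigma> * Var u) ^ expo t u * \<sigma> ^ (d - expo t u)"
        by (simp add: power_mult_distrib mult_ac)
    qed
    also have "\<dots> - g t \<in> J"
      unfolding g_def by (intro cong_prod cong_mult cong_power b'(2)) (simp_all add: zero_mem)
    finally show ?thesis .
  qed
  let ?B = "(\<lambda>t. Poly_Mapping.single t (1 :: 'k)) ` monom_box W (c * card U * d)"
  have "card ?B \<le> card (monom_box W (c * card U * d))"
    using W by (intro card_image_le finite_monom_box)
  also have "\<dots> < card (monom_box U d)"
    using d by (simp add: card_monom_box U W)
  finally have "card ?B < card (monom_box U d)" .
  then have "\<exists>l. (\<exists>t\<in>monom_box U d. l t \<noteq> 0) \<and> (\<Sum>t\<in>monom_box U d. Const (l t) * g t) = 0"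
    using U W g_box
    by (intro vector_space.linear_relation_if_card_less[OF vector_space_dpoly, of _ ?B])
       (auto simp: finite_monom_box intro: polys_box_in_span)
  then obtain l t0 where t0: "t0 \<in> monom_box U d" "l t0 \<noteq> 0"
    and rel: "(\<Sum>t\<in>monom_box U d. Const (l t) * g t) = 0" by blast
  \<comment> \<open>The relation among the \<open>g t\<close>, with each \<open>g t\<close> replaced
    by the monomial \<open>t\<close>. Distinct monomials cannot cancel, so \<open>f\<close> is
    non-zero, while a power of \<open>\<sigma>\<close> times \<open>f\<close> lies in
    \<open>J\<close> and that power does not.\<close>
  define f where "f = (\<Sum>t\<in>monom_box U d. Poly_Mapping.single t (l t))"
  have "coef f t0 = l t0"
    using t0(1) finite_monom_box[OF U] by (simp add: f_def lookup_sum lookup_single when_def)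
  then have "f \<noteq> 0" using t0(2) by auto
  moreover have "f \<in> polys_in U"
    unfolding f_def by (rule polys_in_sum) (auto simp: polys_in_def vars_def monom_box_def)
  moreover have "f \<in> J"
  proof -
    have "\<sigma> ^ (d * card U) * f = (\<Sum>t\<in>monom_box U d. Const (l t) * (\<sigma> ^ (d * card U) * Poly_Mapping.single t 1))"
      unfolding f_def sum_distrib_left
      by (intro sum.cong refl, subst single_eq_Const_mult) (simp only: mult_ac)
    also have "\<dots> = (\<Sum>t\<in>monom_box U d. Const (l t) * (\<sigma> ^ (d * card U) * Poly_Mapping.single t 1 - g t))"
      using rel by (simp add: right_diff_distrib sum_subtractf)
    also have "\<dots> \<in> J" by (intro sum_mem mult_mem g_cong)
    finally show ?thesis using prime s(2) by (metis \<sigma>_def power_notin)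
  qed
  ultimately show ?thesis by blast
qed

end


section \<open>The chain rule derivation\<close>

text \<open>With $y^{(j)}$ read as $f^{(j)} \circ g$, this is differentiation with respect to the
  argument of $g$.\<close>

fun chain_indet_deriv :: "indet \<Rightarrow> 'k::comm_ring_1 dpoly" where
  "chain_indet_deriv Ix = 1"
| "chain_indet_deriv (Iy j) = Var (Iz 1) * Var (Iy (Suc j))"
| "chain_indet_deriv (Iz j) = Var (Iz (Suc j))"
| "chain_indet_deriv (Iw j) = Var (Iw (Suc j))"

definition chain_D :: "'k::comm_ring_1 dpoly \<Rightarrow> 'k dpoly"
  where "chain_D = deriv_ext chain_indet_deriv"

lemma chain_D_add: "chain_D (a + b) = chain_D a + chain_D b"
  and chain_D_mult: "chain_D (a * b) = chain_D a * b + a * chain_D b"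
  and chain_D_0 [simp]: "chain_D 0 = 0"
  and chain_D_Const [simp]: "chain_D (Const c) = 0"
  and chain_D_Var [simp]: "chain_D (Var v) = chain_indet_deriv v"
  by (simp_all add: chain_D_def deriv_ext_add deriv_ext_mult)

lemma chain_D_diff: "chain_D (a - b) = chain_D a - chain_D b"
  using chain_D_add[of "a - b" b] by simp

lemma chain_D_eq_D: "a \<in> polys_in ({Ix} \<union> range Iz) \<Longrightarrow> chain_D a = D a"
  unfolding chain_D_def D_def by (erule deriv_ext_cong) auto

lemma polys_in_D: "V = {Ix} \<union> range Iy \<or> V = {Ix} \<union> range Iz \<Longrightarrow> a \<in> polys_in V \<Longrightarrow> D a \<in> polys_in V"
  unfolding D_def by (rule polys_in_deriv_ext) (auto intro!: polys_in_Var)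

lemma polys_in_D_power:
  "V = {Ix} \<union> range Iy \<or> V = {Ix} \<union> range Iz \<Longrightarrow> a \<in> polys_in V \<Longrightarrow> (D ^^ k) a \<in> polys_in V"
  by (induction k) (auto intro: polys_in_D)

text \<open>Substituting z for x replaces the derivative 1 of x by z', and
  \<open>chain_indet_deriv\<close> gives each \<open>Iy j\<close> the same factor z'. Hence the rule
  holds on the indeterminates, and sums and products preserve it.\<close>

lemma chain_D_p_tilde:
  assumes "p \<in> polys_in ({Ix} \<union> range Iy)"
  shows "chain_D (p_tilde p j) = Var (Iz 1) * p_tilde p (Suc j)"
proof -
  let ?\<sigma> = "Var(Ix := Var (Iz 0))"
  have "chain_D (subst ?\<sigma> a) = Var (Iz 1) * subst ?\<sigma> (D a)" if "a \<in> polys_in ({Ix} \<union> range Iy)" for a :: "'a dpoly"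
    using that
  proof (induction rule: polys_in_induct)
    case (Var v)
    have "subst \<sigma> 1 = (1 :: 'a dpoly)" for \<sigma> using subst_Const[of \<sigma> 1] by simp
    then show ?case using Var by (auto simp: subst_Var D_Var)
  next
    case (Const c)
    have "subst \<sigma> 0 = (0 :: 'a dpoly)" for \<sigma> using subst_Const[of \<sigma> 0] by simp
    then show ?case by (simp add: subst_Const D_Const)
  qed (simp_all add: subst_add subst_mult D_add D_mult chain_D_add chain_D_mult algebra_simps)
  from this[OF polys_in_D_power[OF _ assms]] show ?thesis by (simp add: p_tilde_def)
qed

text \<open>The recursion is the product rule for \<open>chain_D\<close>, which agrees with
  \<open>D\<close> on the coefficients since these involve only z and its derivatives.\<close>

lemma chain_D_S: "chain_D (S j) = (S (Suc j) :: 'k::comm_ring_1 dpoly)"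
proof -
  have c: "chain_D (S_coeff j i) = (D (S_coeff j i) :: 'k dpoly)" for i
    using S_coeff_in by (rule chain_D_eq_D[OF polys_in_mono]) auto
  have "chain_D (S j :: 'k dpoly) = (\<Sum>i\<le>j. chain_D (S_coeff j i * Var (Iy i)))"
    unfolding S_def chain_D_def by (rule deriv_ext_sum)
  also have "\<dots> = S (Suc j)"
    by (subst S_Suc[OF S_coeff_in S_def]) (simp add: chain_D_mult c algebra_simps)
  finally show ?thesis .
qed

text \<open>These generate the union of all \<open>H p q m n N\<close>. Passing to the union removes
  the bounds on the orders and makes stability under \<open>chain_D\<close> possible.\<close>

definition composition_gens :: "'k::comm_ring_1 dpoly \<Rightarrow> 'k dpoly \<Rightarrow> 'k dpoly set"
  where "composition_gens p q =
    range (p_tilde p) \<union> range (\<lambda>i. (D ^^ i) q) \<union> range (\<lambda>i. Var (Iw i) - S i)"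

lemma chain_D_stable:
  assumes p: "p \<in> polys_in ({Ix} \<union> range Iy)" and q: "q \<in> polys_in ({Ix} \<union> range Iz)"
    and a: "a \<in> ideal_gen (composition_gens p q)"
  shows "chain_D a \<in> ideal_gen (composition_gens p q)"
proof -
  interpret ring_ideal "ideal_gen (composition_gens p q)" by (rule ring_ideal_ideal_gen)
  have gen: "b \<in> ideal_gen (composition_gens p q)" if "b \<in> composition_gens p q" for b
    using that unfolding ideal_gen_def by (rule module.span_base[OF module_mult])
  \<comment> \<open>Membership of \<open>a\<close> itself is part of the induction because
    \<open>chain_D (r * b)\<close> contains the term \<open>chain_D r * b\<close>.\<close>
  have "a \<in> ideal_gen (composition_gens p q) \<and> chain_D a \<in> ideal_gen (composition_gens p q)"
    using a
  proof (induction rule: ideal_gen_induct)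
    case (base b)
    then consider i where "b = p_tilde p i" | i where "b = (D ^^ i) q" | i where "b = Var (Iw i) - S i"
      by (auto simp: composition_gens_def)
    then have "chain_D b \<in> ideal_gen (composition_gens p q)"
    proof cases
      case 1
      have "p_tilde p (Suc i) \<in> composition_gens p q" by (simp add: composition_gens_def)
      then show ?thesis unfolding 1 chain_D_p_tilde[OF p] by (intro mult_mem gen)
    next
      case 2
      have "(D ^^ Suc i) q \<in> composition_gens p q" unfolding composition_gens_def by blast
      then show ?thesis
        using chain_D_eq_D[OF polys_in_D_power[OF _ q]] unfolding 2 by (simp add: gen)
    next
      case 3
      have "Var (Iw (Suc i)) - S (Suc i) \<in> composition_gens p q" by (simp add: composition_gens_def)
      then show ?thesis unfolding 3 by (simp add: chain_D_diff chain_D_S gen)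
    qed
    then show ?case using base gen by blast
  qed (auto simp: chain_D_add chain_D_mult zero_mem intro: add_mem mult_mem mult_mem2)
  then show ?thesis ..
qed

text \<open>An element involves only finitely many generators, the ideals increase with
  \<open>N\<close>, and a generator of index \<open>i\<close> already lies in
  \<open>H p q m n i\<close>, since \<open>i \<le> i + min m n\<close>.\<close>

lemma ideal_gen_composition_gens:
  assumes "a \<in> ideal_gen (composition_gens p q)"
  shows "\<exists>N. a \<in> H p q m n N"
proof -
  define K where "K N = p_tilde p ` {..N} \<union> (\<lambda>i. (D ^^ i) q) ` {..N} \<union>
    (\<lambda>i. Var (Iw i) - S i) ` {..N + min m n}" for N
  have H: "H p q m n N = ideal_gen (K N)" for N
    unfolding H_def I_le_def K_def ideal_gen_def module.span_Un[OF module_mult] by blast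
  have mono: "ideal_gen (K M) \<subseteq> ideal_gen (K N)" if "M \<le> N" for M N
    unfolding ideal_gen_def
    by (rule module.span_mono[OF module_mult]) (use that in \<open>auto simp: K_def\<close>)
  have K: "ring_ideal (ideal_gen (K N))" for N by (rule ring_ideal_ideal_gen)
  have "\<exists>N. a \<in> ideal_gen (K N)"
    using assms
  proof (induction rule: ideal_gen_induct)
    case (base b)
    then obtain i where "b = p_tilde p i \<or> b = (D ^^ i) q \<or> b = Var (Iw i) - S i"
      by (auto simp: composition_gens_def)
    then have "b \<in> K i" by (auto simp: K_def)
    then have "b \<in> ideal_gen (K i)"
      unfolding ideal_gen_def by (rule module.span_base[OF module_mult])
    then show ?case ..
  next
    case zero
    show ?case using ring_ideal.zero_mem[OF K] by blast
  next
    case (add b c)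
    then obtain M N where "b \<in> ideal_gen (K M)" "c \<in> ideal_gen (K N)" by blast
    then have "b \<in> ideal_gen (K (max M N))" "c \<in> ideal_gen (K (max M N))"
      using mono[of M "max M N"] mono[of N "max M N"] by auto
    then show ?case using ring_ideal.add_mem[OF K] by blast
  next
    case (mult r b)
    then show ?case using ring_ideal.mult_mem[OF K] by blast
  qed
  then show ?thesis by (simp add: H)
qed

section \<open>The outer equation as a relation over z\<close>

lemma p_tilde_0_nonzero:
  assumes p: "p \<in> polys_in ({Ix} \<union> range Iy)" and "p \<noteq> 0"
  shows "p_tilde p 0 \<noteq> 0"
proof
  assume 0: "p_tilde p 0 = 0"
  \<comment> \<open>Substituting x back for z is a left inverse, because z does not occur in
    \<open>p\<close>.\<close>
  have "subst (Var(Iz 0 := Var Ix)) (subst (Var(Ix := Var (Iz 0))) p) = p"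
    using p by (induction rule: polys_in_induct) (auto simp: subst_Const subst_Var subst_add subst_mult)
  moreover have "subst (Var(Iz 0 := Var Ix)) (0 :: 'a dpoly) = 0"
    using subst_Const[of _ 0] by simp
  ultimately show False using 0 \<open>p \<noteq> 0\<close> by (simp add: p_tilde_def)
qed

lemma p_tilde_0_in:
  fixes p :: "'k::comm_ring_1 dpoly"
  assumes "p \<in> polys_in ({Ix} \<union> range Iy)"
  shows "p_tilde p 0 \<in> polys_in ({Iz 0} \<union> range Iy)"
proof -
  have "subst (Var(Ix := Var (Iz 0))) p \<in> polys_in ({Iz 0} \<union> range Iy)"
    using assms
    by (induction rule: polys_in_induct)
       (auto simp: subst_Const subst_Var subst_add subst_mult
          intro: polys_in_Const polys_in_add polys_in_mult intro!: polys_in_Var)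
  then show ?thesis by (simp add: p_tilde_def)
qed

text \<open>Only the values at \<open>Iz 0\<close> and \<open>Iy j\<close> matter.\<close>

definition outer_deriv :: "indet \<Rightarrow> 'k::comm_ring_1 dpoly"
  where "outer_deriv v = (case v of Iy j \<Rightarrow> Var (Iy (Suc j)) | _ \<Rightarrow> 1)"

text \<open>A prime ideal stable under \<open>chain_D\<close> and not containing z' is therefore
  stable under \<open>deriv_ext outer_deriv\<close> on this subring: the factor z' can be
  cancelled.\<close>

lemma chain_D_eq_outer:
  assumes "a \<in> polys_in ({Iz 0} \<union> range Iy)"
  shows "chain_D a = Var (Iz 1) * deriv_ext outer_deriv a"
  using assms
  by (induction rule: polys_in_induct)
     (auto simp: outer_deriv_def chain_D_add chain_D_mult deriv_ext_add deriv_ext_mult algebra_simps)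

lemma S_in: "S j \<in> polys_in (range Iz \<union> range Iy)"
  unfolding S_def
  by (intro polys_in_sum polys_in_mult polys_in_mono[OF S_coeff_in] polys_in_Var) auto

lemma of_nat_dvd_1: "n > 0 \<Longrightarrow> (of_nat n :: 'k::field_char_0 dpoly) dvd 1"
proof -
  assume "n > 0"
  then have "1 = Const (of_nat n) * (Const (inverse (of_nat n)) :: 'k dpoly)"
    by (simp flip: Const_mult)
  then show "(of_nat n :: 'k dpoly) dvd 1" by (simp add: Const_def dvd_def) metis
qed

theorem proposition4p3:
  fixes p q :: "'k::field_char_0 dpoly" and m n :: nat
  assumes "p \<in> polys_in ({Ix} \<union> range Iy)" and "has_order Iy p m"
    and "q \<in> polys_in ({Ix} \<union> range Iz)" and "has_order Iz q n"
  shows "\<exists>N. H p q m n N \<inter> polys_in ({Ix} \<union> range Iw) \<noteq> {0}"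
proof -
  let ?I = "ideal_gen (composition_gens p q)"
  \<comment> \<open>Closed under products, since the polynomials form an integral domain. An ideal
    disjoint from it meets the ring in x and the \<open>Iw j\<close> only in 0.\<close>
  let ?M = "polys_in ({Ix} \<union> range Iw) - {0 :: 'k dpoly}"
  have nonzero: "p \<noteq> 0" "q \<noteq> 0" using assms(2,4) by (auto simp: has_order_def vars_def)
  have "?I \<inter> ?M \<noteq> {}"
  proof
    assume "?I \<inter> ?M = {}"
    then have "\<exists>J. ?I \<subseteq> J \<and> prime_ideal J \<and> J \<inter> ?M = {}"
      by (intro ex_prime_ideal_disjoint ring_ideal_ideal_gen) (auto intro: polys_in_mult)
    then obtain J\<^sub>0 where J\<^sub>0: "?I \<subseteq> J\<^sub>0" "prime_ideal J\<^sub>0" "J\<^sub>0 \<inter> ?M = {}" by blast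
    \<comment> \<open>The prime ideal from Zorn's lemma need not be stable under
      \<open>chain_D\<close>. Its differential core is, remains prime, and still contains
      \<open>?I\<close> because \<open>?I\<close> itself is stable.\<close>
    define J where "J = {a. \<forall>k. (chain_D ^^ k) a \<in> J\<^sub>0}"
    have "prime_ideal J" unfolding J_def
      by (rule prime_ideal_differential_core[OF chain_D_add chain_D_mult of_nat_dvd_1 J\<^sub>0(2)])
    then interpret prime_dpoly_ideal J by (simp add: prime_dpoly_ideal_def)
    have "a \<in> J\<^sub>0" if "a \<in> J" for a using that[unfolded J_def, simplified, THEN spec, of 0] by simp
    then have disj: "f = 0" if "f \<in> J" "f \<in> polys_in ({Ix} \<union> range Iw)" for f
      using J\<^sub>0(3) that by blast
    have stable: "chain_D a \<in> J" if "a \<in> J" for a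
      using that funpow_swap1[of chain_D] unfolding J_def mem_Collect_eq by (metis funpow.simps(2) o_apply)
    have "(chain_D ^^ k) a \<in> ?I" if "a \<in> ?I" for a k
      using that by (induction k) (auto intro: chain_D_stable assms)
    then have "?I \<subseteq> J" using J\<^sub>0(1) by (auto simp: J_def)
    then have gens: "a \<in> J" if "a \<in> composition_gens p q" for a
      using that module.span_base[OF module_mult] unfolding ideal_gen_def by blast
    have w: "Var (Iw i) - S i \<in> J" for i by (rule gens) (simp add: composition_gens_def)
    \<comment> \<open>Otherwise \<open>S 1\<close>, which is z' times y', would put w' into
      \<open>J\<close>, against \<open>disj\<close>.\<close>
    have z1: "Var (Iz 1) \<notin> J"
    proof
      assume "Var (Iz 1) \<in> J"
      moreover have "S 1 = Var (Iz 1) * (Var (Iy 1) :: 'k dpoly)"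
        using chain_D_S[of 0, where 'k = 'k] by (simp add: S_0)
      ultimately have "S 1 \<in> J" by (simp add: mult_mem2)
      then have "Var (Iw 1) \<in> J" using add_mem[OF w[of 1], of "S 1"] by simp
      then have "Var (Iw 1) = (0 :: 'k dpoly)" by (intro disj polys_in_Var) auto
      then show False by (metis Var_def lookup_single_eq lookup_zero zero_neq_one)
    qed
    \<comment> \<open>The inner equation \<open>q\<close>, with x as the independent
      variable.\<close>
    have "\<exists>s N. s \<in> polys_in ({Ix} \<union> Iz ` {..N}) \<and> s \<notin> J \<and>
        (\<forall>j. Var (Iz j) \<in> rational_over J s ({Ix} \<union> Iz ` {..N}))"
    proof (rule differential_relation_rational[where \<delta> = chain_indet_deriv and f = q])
      have "(D ^^ 0) q \<in> composition_gens p q" unfolding composition_gens_def by blast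
      then show "q \<in> J" using gens by simp
    qed (use assms nonzero stable in \<open>auto simp: inj_def chain_D_def\<close>)
    then obtain s1 N1 where s1: "s1 \<in> polys_in ({Ix} \<union> Iz ` {..N1})" "s1 \<notin> J"
      "\<And>j. Var (Iz j) \<in> rational_over J s1 ({Ix} \<union> Iz ` {..N1})" by blast
    \<comment> \<open>The outer equation, with z as the independent variable in place of x.\<close>
    have "\<exists>s N. s \<in> polys_in ({Iz 0} \<union> Iy ` {..N}) \<and> s \<notin> J \<and>
        (\<forall>j. Var (Iy j) \<in> rational_over J s ({Iz 0} \<union> Iy ` {..N}))"
    proof (rule differential_relation_rational[where \<delta> = outer_deriv and f = "p_tilde p 0"])
      show "deriv_ext outer_deriv a \<in> J" if "a \<in> J" "a \<in> polys_in ({Iz 0} \<union> range Iy)" for a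
        using stable[OF that(1)] prime z1 unfolding chain_D_eq_outer[OF that(2)] by blast
      show "p_tilde p 0 \<in> J" by (rule gens) (simp add: composition_gens_def)
    qed (use assms nonzero in \<open>auto simp: inj_def outer_deriv_def p_tilde_0_nonzero p_tilde_0_in[simplified]\<close>)
    then obtain s2 N2 where s2: "s2 \<in> polys_in ({Iz 0} \<union> Iy ` {..N2})" "s2 \<notin> J"
      "\<And>j. Var (Iy j) \<in> rational_over J s2 ({Iz 0} \<union> Iy ` {..N2})" by blast
    define W where "W = ({Ix} \<union> Iz ` {..N1}) \<union> ({Iz 0} \<union> Iy ` {..N2})"
    define s where "s = s1 * s2"
    have sW: "s1 \<in> polys_in W" "s2 \<in> polys_in W"
      using polys_in_mono[OF s1(1), of W] polys_in_mono[OF s2(1), of W] by (auto simp: W_def)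
    then have s: "s \<in> polys_in W" "s \<notin> J"
      using s1(2) s2(2) prime by (auto simp: s_def polys_in_mult)
    have z: "Var (Iz j) \<in> rational_over J s W" for j
      unfolding s_def by (rule rational_over_mono[OF s1(3) _ sW(2)]) (auto simp: W_def)
    have y: "Var (Iy j) \<in> rational_over J s W" for j
      unfolding s_def mult.commute[of s1]
      by (rule rational_over_mono[OF s2(3) _ sW(1)]) (auto simp: W_def)
    have S: "S j \<in> rational_over J s W" for j
      using z y by (intro rational_over_polys[OF s(1) _ S_in]) auto
    have w': "Var (Iw j) \<in> rational_over J s W" for j
      using rational_over_add[OF s(1) rational_over_ideal[OF w[of j]] S[of j]] by simp
    have x: "Var Ix \<in> rational_over J s W"
      by (intro rational_over_polys_in polys_in_Var) (simp add: W_def)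
    \<comment> \<open>These are \<open>card W + 2\<close> indeterminates, all rational over
      \<open>W\<close> modulo \<open>J\<close>, so counting yields a non-zero relation among x and
      finitely many \<open>Iw j\<close>.\<close>
    let ?U = "{Ix} \<union> Iw ` {..card W}"
    have "card (Iw ` {..card W}) = Suc (card W)" by (subst card_image) (auto simp: inj_on_def)
    then have "card ?U = Suc (Suc (card W))" by (simp add: card_insert_if image_iff)
    then have "\<exists>f. f \<in> J \<and> f \<in> polys_in ?U \<and> f \<noteq> 0"
      by (intro algebraic_relation_if_card_less[of _ W s] s) (auto simp: W_def[symmetric] w' x, simp add: W_def)
    then obtain f where f: "f \<in> J" "f \<in> polys_in ?U" "f \<noteq> 0" by blast
    moreover have "f \<in> polys_in ({Ix} \<union> range Iw)" using f(2) by (rule polys_in_mono) auto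
    ultimately show False using disj by blast
  qed
  then obtain f where "f \<in> ?I" "f \<in> polys_in ({Ix} \<union> range Iw)" "f \<noteq> 0" by blast
  moreover obtain N where "f \<in> H p q m n N"
    using ideal_gen_composition_gens[OF \<open>f \<in> ?I\<close>] by blast
  ultimately show ?thesis by blast
qed

end
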